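(* Let $X$ and $Y$ be positive definite random matrices (with values in $M_n$) on a probability space $(\Omega,\mathcal F,P)$. For $f\in\mathcal F_{op}$ the inequality $$\mathrm{E}\,\mathrm{E}_\rho\bigl(m_f(X,Y)\bigr)\le m_f\bigl(\mathrm{E}\,\mathrm{E}_\rho(X),\ \mathrm{E}\,\mathrm{E}_\rho(Y)\bigr)$$ holds for each random density matrix $\rho\colon\Omega\to M_n$ on $(\Omega,\mathcal F,P)$.
   Context: $M_n$ denotes the $n\times n$ matrices. A random matrix is a map $X\colon\Omega\to M_n$. It is a positive definite random matrix if $X(\omega)$ is positive definite for $P$-almost all $\omega\in\Omega$, and positive semi-definite random matrices are defined analogously. A random density matrix is a positive semi-definite random matrix $\rho$ with $\operatorname{Tr}\rho(\omega)=1$ for $P$-almost all $\omega$. For a random matrix $X$ and a random density matrix $\rho$, the pointwise expectation $\mathrm{E}_\rho(X)$ is the random variable $(\mathrm{E}_\rho X)(\omega)=\operatorname{Tr}\bigl(\rho(\omega)X(\omega)\bigr)$, and its mean is $\mathrm{E}\,\mathrm{E}_\rho(X)=\int_\Omega\operatorname{Tr}\bigl(\rho(\omega)X(\omega)\bigr)\,dP(\omega)$. A function $f\colon(0,\infty)\to\mathbb R$ is operator monotone (increasing) if $A\le B$ implies $f(A)\le f(B)$ for positive definite operators $A,B$ on an arbitrary Hilbert space, where $f(A)$ is defined by the functional calculus. $\mathcal F_{op}$ is the class of functions $f\colon(0,\infty)\to(0,\infty)$ such that: (1) $f$ is operator monotone increasing; (2) $t f(t^{-1})=f(t)$ for all $t>0$;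 (3) $f(1)=1$. For positive definite matrices $A,B$, the mean associated with $f$ is $m_f(A,B)=A^{1/2}f(A^{-1/2}BA^{-1/2})A^{1/2}$; for positive real numbers $a,b$ this reads $m_f(a,b)=a f(a^{-1}b)$. The random matrix $m_f(X,Y)$ is defined pointwise (almost everywhere) by $m_f(X,Y)(\omega)=m_f(X(\omega),Y(\omega))$. *)

theory Defs
  imports
    "HOL-Probability.Probability"
    "HOL-Computational_Algebra.Polynomial"
    "HOL-Library.Infinite_Typeclass"
begin

section \<open>Complex Hilbert spaces and operator monotone functions\<close>

text \<open>
  Operator monotonicity refers to operators on an arbitrary Hilbert space. As HOL cannot quantify
  over types inside a definition, Hilbert spaces are structures whose carrier is a subset of a
  type; all Hilbert spaces with carrier in that type are then quantified over. For infinite \<open>'i\<close>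
  the type \<open>'i \<Rightarrow> complex\<close> contains a copy of every Hilbert space of dimension at most \<open>|'i|\<close>, in
  particular of every separable one.
\<close>

record 'h hspace =
  hcarrier :: "'h set"
  hzero :: 'h
  hadd :: "'h \<Rightarrow> 'h \<Rightarrow> 'h"
  hscale :: "complex \<Rightarrow> 'h \<Rightarrow> 'h"
  hinner :: "'h \<Rightarrow> 'h \<Rightarrow> complex"

definition hminus :: "'h hspace \<Rightarrow> 'h \<Rightarrow> 'h \<Rightarrow> 'h" where
  "hminus H x y = hadd H x (hscale H (- 1) y)"

definition hnorm :: "'h hspace \<Rightarrow> 'h \<Rightarrow> real" where
  "hnorm H x = sqrt (Re (hinner H x x))"

text \<open>The inner product is linear in its second argument.\<close>

locale hilbert_space =
  fixes H :: "'h hspace"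
  assumes zero_closed: "hzero H \<in> hcarrier H"
    and add_closed: "\<lbrakk>x \<in> hcarrier H; y \<in> hcarrier H\<rbrakk> \<Longrightarrow> hadd H x y \<in> hcarrier H"
    and scale_closed: "x \<in> hcarrier H \<Longrightarrow> hscale H c x \<in> hcarrier H"
    and add_assoc: "\<lbrakk>x \<in> hcarrier H; y \<in> hcarrier H; z \<in> hcarrier H\<rbrakk> \<Longrightarrow>
          hadd H (hadd H x y) z = hadd H x (hadd H y z)"
    and add_commute: "\<lbrakk>x \<in> hcarrier H; y \<in> hcarrier H\<rbrakk> \<Longrightarrow> hadd H x y = hadd H y x"
    and add_zero: "x \<in> hcarrier H \<Longrightarrow> hadd H x (hzero H) = x"
    and minus_self: "x \<in> hcarrier H \<Longrightarrow> hminus H x x = hzero H"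
    and scale_add_right: "\<lbrakk>x \<in> hcarrier H; y \<in> hcarrier H\<rbrakk> \<Longrightarrow>
          hscale H c (hadd H x y) = hadd H (hscale H c x) (hscale H c y)"
    and scale_add_left: "x \<in> hcarrier H \<Longrightarrow>
          hscale H (c + d) x = hadd H (hscale H c x) (hscale H d x)"
    and scale_scale: "x \<in> hcarrier H \<Longrightarrow> hscale H c (hscale H d x) = hscale H (c * d) x"
    and scale_one: "x \<in> hcarrier H \<Longrightarrow> hscale H 1 x = x"
    and inner_add_right: "\<lbrakk>x \<in> hcarrier H; y \<in> hcarrier H; z \<in> hcarrier H\<rbrakk> \<Longrightarrow>
          hinner H x (hadd H y z) = hinner H x y + hinner H x z"
    and inner_scale_right: "\<lbrakk>x \<in> hcarrier H; y \<in> hcarrier H\<rbrakk> \<Longrightarrow>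
          hinner H x (hscale H c y) = c * hinner H x y"
    and inner_commute: "\<lbrakk>x \<in> hcarrier H; y \<in> hcarrier H\<rbrakk> \<Longrightarrow> hinner H y x = cnj (hinner H x y)"
    and inner_pos: "\<lbrakk>x \<in> hcarrier H; x \<noteq> hzero H\<rbrakk> \<Longrightarrow> 0 < Re (hinner H x x)"
    and complete: "Metric_space.mcomplete (hcarrier H) (\<lambda>x y. hnorm H (hminus H x y))"

text \<open>Operators are functions on the carrier type; only their values on the carrier matter.\<close>

definition bounded_operator :: "'h hspace \<Rightarrow> ('h \<Rightarrow> 'h) \<Rightarrow> bool" where
  "bounded_operator H A \<longleftrightarrow>
     (\<forall>x\<in>hcarrier H. A x \<in> hcarrier H) \<and>
     (\<forall>x\<in>hcarrier H. \<forall>y\<in>hcarrier H. A (hadd H x y) = hadd H (A x) (A y)) \<and>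
     (\<forall>c. \<forall>x\<in>hcarrier H. A (hscale H c x) = hscale H c (A x)) \<and>
     (\<exists>K. \<forall>x\<in>hcarrier H. hnorm H (A x) \<le> K * hnorm H x)"

definition selfadjoint_operator :: "'h hspace \<Rightarrow> ('h \<Rightarrow> 'h) \<Rightarrow> bool" where
  "selfadjoint_operator H A \<longleftrightarrow> bounded_operator H A \<and>
     (\<forall>x\<in>hcarrier H. \<forall>y\<in>hcarrier H. hinner H (A x) y = hinner H x (A y))"

definition operator_le :: "'h hspace \<Rightarrow> ('h \<Rightarrow> 'h) \<Rightarrow> ('h \<Rightarrow> 'h) \<Rightarrow> bool" where
  "operator_le H A B \<longleftrightarrow> selfadjoint_operator H A \<and> selfadjoint_operator H B \<and>
     (\<forall>x\<in>hcarrier H. Re (hinner H x (A x)) \<le> Re (hinner H x (B x)))"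

definition spectrum :: "'h hspace \<Rightarrow> ('h \<Rightarrow> 'h) \<Rightarrow> complex set" where
  "spectrum H A = {z. \<not> (\<exists>R. bounded_operator H R \<and>
     (\<forall>x\<in>hcarrier H. R (hminus H (A x) (hscale H z x)) = x \<and>
                       hminus H (A (R x)) (hscale H z (R x)) = x))}"

text \<open>
  Positive definite operators are positive and invertible; equivalently, selfadjoint with spectrum
  in the open half-line. Mere strict positivity of the quadratic form would be too weak in infinite
  dimension.
\<close>

definition posdef_operator :: "'h hspace \<Rightarrow> ('h \<Rightarrow> 'h) \<Rightarrow> bool" where
  "posdef_operator H A \<longleftrightarrow> operator_le H (\<lambda>x. hzero H) A \<and> 0 \<notin> spectrum H A"

text \<open>Horner evaluation: \<open>p = a + t * q\<close> gives \<open>p(A) x = a x + A (q(A) x)\<close>.\<close>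

definition operator_poly :: "'h hspace \<Rightarrow> real poly \<Rightarrow> ('h \<Rightarrow> 'h) \<Rightarrow> 'h \<Rightarrow> 'h" where
  "operator_poly H p A =
     fold_coeffs (\<lambda>a g x. hadd H (hscale H (complex_of_real a) x) (A (g x))) p (\<lambda>x. hzero H)"

text \<open>
  Continuous functional calculus of a selfadjoint operator, as a relation: \<open>T = f(A)\<close> is the
  operator norm limit of \<open>p\<^sub>k(A)\<close> for real polynomials converging to \<open>f\<close> uniformly on the spectrum
  of \<open>A\<close>. By the spectral theorem \<open>T\<close> is unique on the carrier, and it exists exactly if \<open>f\<close> is
  continuous on the spectrum (in particular always in finite dimension).
\<close>

definition functional_calculus ::
  "'h hspace \<Rightarrow> (real \<Rightarrow> real) \<Rightarrow> ('h \<Rightarrow> 'h) \<Rightarrow> ('h \<Rightarrow> 'h) \<Rightarrow> bool" where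
  "functional_calculus H f A T \<longleftrightarrow> bounded_operator H T \<and>
     (\<exists>p :: nat \<Rightarrow> real poly.
        uniform_limit {t. complex_of_real t \<in> spectrum H A} (\<lambda>k. poly (p k)) f sequentially \<and>
        (\<forall>\<epsilon>>0. \<forall>\<^sub>F k in sequentially. \<forall>x\<in>hcarrier H.
           hnorm H (hminus H (operator_poly H (p k) A x) (T x)) \<le> \<epsilon> * hnorm H x))"

text \<open>
  \<open>f(A) \<le> f(B)\<close> is required whenever both are defined. No continuity of \<open>f\<close> is assumed separately:
  it follows from the condition on two-dimensional spaces.
\<close>

definition operator_monotone :: "'h itself \<Rightarrow> (real \<Rightarrow> real) \<Rightarrow> bool" where
  "operator_monotone _ f \<longleftrightarrow>
     (\<forall>(H :: 'h hspace) A B S T.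
        hilbert_space H \<and> posdef_operator H A \<and> posdef_operator H B \<and> operator_le H A B \<and>
        functional_calculus H f A S \<and> functional_calculus H f B T \<longrightarrow>
        operator_le H S T)"

text \<open>Functions on the open half-line are total functions whose values on \<open>{..0}\<close> are irrelevant.\<close>

definition F_op :: "'h itself \<Rightarrow> (real \<Rightarrow> real) set" where
  "F_op U = {f. (\<forall>t>0. f t > 0) \<and> operator_monotone U f \<and>
                (\<forall>t>0. t * f (inverse t) = f t) \<and> f 1 = 1}"


section \<open>Matrices\<close>

definition madjoint :: "complex^'n^'n \<Rightarrow> complex^'n^'n" where
  "madjoint A = transpose (map_matrix cnj A)"

definition cinner_vec :: "complex^'n \<Rightarrow> complex^'n \<Rightarrow> complex" where
  "cinner_vec x y = (\<Sum>i\<in>UNIV. cnj (x $ i) * y $ i)"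

definition posdef :: "complex^'n^'n \<Rightarrow> bool" where
  "posdef A \<longleftrightarrow> madjoint A = A \<and> (\<forall>x. x \<noteq> 0 \<longrightarrow> Re (cinner_vec x (A *v x)) > 0)"

definition possemidef :: "complex^'n^'n \<Rightarrow> bool" where
  "possemidef A \<longleftrightarrow> madjoint A = A \<and> (\<forall>x. Re (cinner_vec x (A *v x)) \<ge> 0)"

definition diag_mat :: "('n \<Rightarrow> real) \<Rightarrow> complex^'n^'n" where
  "diag_mat d = (\<chi> i j. if i = j then complex_of_real (d i) else 0)"

definition unitary :: "complex^'n^'n \<Rightarrow> bool" where
  "unitary U \<longleftrightarrow> madjoint U ** U = mat 1 \<and> U ** madjoint U = mat 1"

text \<open>
  Functional calculus for Hermitian matrices. The result does not depend on the chosen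
  diagonalization, so the description is proper for every Hermitian \<open>A\<close>.
\<close>

definition mat_fun :: "(real \<Rightarrow> real) \<Rightarrow> complex^'n^'n \<Rightarrow> complex^'n^'n" where
  "mat_fun f A = (THE S. \<exists>U d. unitary U \<and> A = U ** diag_mat d ** madjoint U \<and>
                               S = U ** diag_mat (f \<circ> d) ** madjoint U)"

text \<open>
  The mean is defined for positive definite arguments only; it is set to \<open>0\<close> elsewhere, so that
  the exceptional null set of a pair of random matrices does not affect measurability.
\<close>

definition matrix_mean ::
  "(real \<Rightarrow> real) \<Rightarrow> complex^'n^'n \<Rightarrow> complex^'n^'n \<Rightarrow> complex^'n^'n" where
  "matrix_mean f A B =
     (if posdef A \<and> posdef B then
        (let R = mat_fun (\<lambda>t. t powr (1/2)) A; Q = mat_fun (\<lambda>t. t powr (- (1/2))) A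
         in R ** mat_fun f (Q ** B ** Q) ** R)
      else 0)"

definition scalar_mean :: "(real \<Rightarrow> real) \<Rightarrow> real \<Rightarrow> real \<Rightarrow> real" where
  "scalar_mean f a b = a * f (inverse a * b)"


section \<open>Random matrices\<close>

definition posdef_random_matrix :: "'w measure \<Rightarrow> ('w \<Rightarrow> complex^'n^'n) \<Rightarrow> bool" where
  "posdef_random_matrix M X \<longleftrightarrow> X \<in> borel_measurable M \<and> (AE \<omega> in M. posdef (X \<omega>))"

definition random_density_matrix :: "'w measure \<Rightarrow> ('w \<Rightarrow> complex^'n^'n) \<Rightarrow> bool" where
  "random_density_matrix M \<rho> \<longleftrightarrow> \<rho> \<in> borel_measurable M \<and>
     (AE \<omega> in M. possemidef (\<rho> \<omega>)) \<and> (AE \<omega> in M. trace (\<rho> \<omega>) = 1)"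

definition pointwise_expectation ::
  "('w \<Rightarrow> complex^'n^'n) \<Rightarrow> ('w \<Rightarrow> complex^'n^'n) \<Rightarrow> 'w \<Rightarrow> complex" where
  "pointwise_expectation \<rho> X = (\<lambda>\<omega>. trace (\<rho> \<omega> ** X \<omega>))"

text \<open>
  For Hermitian \<open>\<rho>\<close> and \<open>X\<close> the trace is real, so taking the real part only changes the type.
\<close>

definition mean_expectation ::
  "'w measure \<Rightarrow> ('w \<Rightarrow> complex^'n^'n) \<Rightarrow> ('w \<Rightarrow> complex^'n^'n) \<Rightarrow> real" where
  "mean_expectation M \<rho> X = Re (integral\<^sup>L M (pointwise_expectation \<rho> X))"

definition random_mean ::
  "(real \<Rightarrow> real) \<Rightarrow> ('w \<Rightarrow> complex^'n^'n) \<Rightarrow> ('w \<Rightarrow> complex^'n^'n) \<Rightarrow> 'w \<Rightarrow> complex^'n^'n" where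
  "random_mean f X Y = (\<lambda>\<omega>. matrix_mean f (X \<omega>) (Y \<omega>))"

end

theory Submission
  imports Defs
begin

text \<open>
  Only the scalar concavity of \<open>f\<close> is needed, and it follows from monotonicity on \<open>2 \<times> 2\<close> matrices:
  a matrix with eigenvalues \<open>a, b\<close> and upper left entry \<open>x\<close> lies below \<open>diag(x + \<epsilon>, \<mu>)\<close> for large \<open>\<mu>\<close>,
  so \<open>f (x + \<epsilon>)\<close> dominates the chord of \<open>f\<close> at \<open>x\<close>; the symmetry \<open>t f(1/t) = f(t)\<close> gives the continuity
  that allows \<open>\<epsilon> \<rightarrow> 0\<close>. Diagonalising \<open>X\<^sup>-\<^sup>1\<^sup>/\<^sup>2 Y X\<^sup>-\<^sup>1\<^sup>/\<^sup>2\<close> with eigenvalues \<open>c\<^sub>j\<close> yields weights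
  \<open>w\<^sub>j \<ge> 0\<close> such that \<open>Tr(\<rho> X) = \<Sum> w\<^sub>j\<close>, \<open>Tr(\<rho> Y) = \<Sum> w\<^sub>j c\<^sub>j\<close> and \<open>Tr(\<rho> m\<^sub>f(X, Y)) = \<Sum> w\<^sub>j f(c\<^sub>j)\<close>.
  The supporting line of \<open>f\<close> at the quotient \<open>t\<^sub>0\<close> of the two means therefore bounds \<open>Tr(\<rho> m\<^sub>f(X, Y))\<close> by a
  fixed linear combination of \<open>Tr(\<rho> X)\<close> and \<open>Tr(\<rho> Y)\<close>, which integrates to the claim.
\<close>

section \<open>Two-dimensional Hilbert spaces and concavity\<close>

text \<open>A copy of C^2 inside the type \<open>'i \<Rightarrow> complex\<close> over which
  \<open>operator_monotone\<close> quantifies; the inner product needs only the two coordinates on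
  which vectors are supported.\<close>

definition plane :: "'i \<Rightarrow> 'i \<Rightarrow> ('i \<Rightarrow> complex) hspace" where
  "plane i j = \<lparr>hcarrier = {x. \<forall>k. k \<noteq> i \<and> k \<noteq> j \<longrightarrow> x k = 0}, hzero = (\<lambda>_. 0),
     hadd = (\<lambda>x y k. x k + y k), hscale = (\<lambda>c x k. c * x k),
     hinner = (\<lambda>x y. cnj (x i) * y i + cnj (x j) * y j)\<rparr>"

text \<open>Acts as the matrix with rows (p, q) and (r, s); the value 0 at all other coordinates
  keeps the image in the carrier.\<close>

definition plane_op ::
  "'i \<Rightarrow> 'i \<Rightarrow> complex \<Rightarrow> complex \<Rightarrow> complex \<Rightarrow> complex \<Rightarrow> ('i \<Rightarrow> complex) \<Rightarrow> 'i \<Rightarrow> complex" where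
  "plane_op i j p q r s x =
     (\<lambda>k. if k = i then p * x i + q * x j else if k = j then r * x i + s * x j else 0)"

lemma plane_simps [simp]:
  "hcarrier (plane i j) = {x. \<forall>k. k \<noteq> i \<and> k \<noteq> j \<longrightarrow> x k = 0}"
  "hzero (plane i j) = (\<lambda>_. 0)"
  "hadd (plane i j) x y = (\<lambda>k. x k + y k)"
  "hscale (plane i j) c x = (\<lambda>k. c * x k)"
  "hinner (plane i j) x y = cnj (x i) * y i + cnj (x j) * y j"
  "hminus (plane i j) x y = (\<lambda>k. x k - y k)"
  by (auto simp: plane_def hminus_def)

lemma hnorm_plane: "hnorm (plane i j) x = norm (x i, x j)"
proof -
  have "Re (cnj z * z) = (norm z)\<^sup>2" for z :: complex
    by (simp add: cmod_power2 flip: power2_eq_square)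
  then show ?thesis
    by (simp add: hnorm_def norm_Pair)
qed

text \<open>For distinct coordinates the map \<open>x \<mapsto> (x i, x j)\<close> is an isometry
  onto \<open>complex \<times> complex\<close>; the metric axioms and completeness are pulled back
  from there.\<close>

lemma hilbert_space_plane:
  assumes "i \<noteq> j"
  shows "hilbert_space (plane i j)"
proof -
  let ?C = "hcarrier (plane i j)" and ?d = "\<lambda>x y. hnorm (plane i j) (hminus (plane i j) x y)"
  have d: "?d x y = dist (x i, x j) (y i, y j)" for x y
    by (simp add: hnorm_plane dist_norm)
  interpret Metric_space ?C ?d
  proof
    fix x y z
    show "?d x y = ?d y x" by (simp only: d dist_commute)
    show "?d x z \<le> ?d x y + ?d y z" by (simp only: d dist_triangle)
    show "(?d x y = 0) = (x = y)" if "x \<in> ?C" "y \<in> ?C"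
      using that unfolding d by (auto simp: fun_eq_iff) metis
  qed (simp add: hnorm_plane)
  have "mcomplete"
    unfolding mcomplete_def
  proof (intro allI impI)
    fix \<sigma> assume \<sigma>: "MCauchy \<sigma>"
    have "Cauchy (\<lambda>n. (\<sigma> n i, \<sigma> n j))"
    proof (rule metric_CauchyI)
      fix e :: real assume "e > 0"
      then have "\<exists>N. \<forall>n n'. N \<le> n \<longrightarrow> N \<le> n' \<longrightarrow> ?d (\<sigma> n) (\<sigma> n') < e"
        using \<sigma> unfolding MCauchy_def by simp
      then show "\<exists>N. \<forall>m\<ge>N. \<forall>n\<ge>N. dist (\<sigma> m i, \<sigma> m j) (\<sigma> n i, \<sigma> n j) < e"
        unfolding d by blast
    qed
    then obtain l where l: "(\<lambda>n. (\<sigma> n i, \<sigma> n j)) \<longlonglongrightarrow> l"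
      using Cauchy_convergent_iff convergent_def by blast
    define x where "x = (\<lambda>k. if k = i then fst l else if k = j then snd l else 0)"
    have l': "(x i, x j) = l" using assms by (simp add: x_def)
    have "limitin mtopology \<sigma> x sequentially"
      unfolding limitin_metric
    proof (intro conjI allI impI)
      show "x \<in> ?C" by (simp add: x_def)
      fix e :: real assume "e > 0"
      then have "\<forall>\<^sub>F n in sequentially. dist (\<sigma> n i, \<sigma> n j) l < e"
        using tendstoD[OF l] by blast
      moreover have "\<forall>n. \<sigma> n \<in> ?C"
        using \<sigma> unfolding MCauchy_def by blast
      ultimately show "\<forall>\<^sub>F n in sequentially. \<sigma> n \<in> ?C \<and> ?d (\<sigma> n) x < e"
        unfolding d l' by simp
    qed
    then show "\<exists>x. limitin mtopology \<sigma> x sequentially" by blast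
  qed
  moreover have "0 < Re (hinner (plane i j) x x)" if "x \<in> ?C" "x \<noteq> hzero (plane i j)" for x
  proof -
    have "x i \<noteq> 0 \<or> x j \<noteq> 0"
      using that by (auto simp: fun_eq_iff)
    then show ?thesis
      by (auto simp: complex_eq_iff sum_power2_gt_zero_iff simp flip: power2_eq_square
            intro: add_pos_nonneg add_nonneg_pos)
  qed
  ultimately show ?thesis
    by unfold_locales (simp_all add: algebra_simps)
qed

section \<open>Two-by-two operators: spectrum, functional calculus and order\<close>

lemma bounded_operator_plane_op:
  assumes "i \<noteq> j"
  shows "bounded_operator (plane i j) (plane_op i j p q r s)"
proof -
  have "hnorm (plane i j) (plane_op i j p q r s x)
      \<le> (norm p + norm q + norm r + norm s) * hnorm (plane i j) x" for x
  proof -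
    have "norm (p * x i + q * x j, r * x i + s * x j)
        \<le> norm (p * x i) + norm (q * x j) + (norm (r * x i) + norm (s * x j))"
      by (meson norm_Pair_le norm_triangle_ineq add_mono order_trans)
    also have "\<dots> \<le> (norm p + norm q + norm r + norm s) * norm (x i, x j)"
      using norm_fst_le[of "x i" "x j"] norm_snd_le[of "x j" "x i"]
      unfolding norm_mult distrib_right add.assoc by (intro add_mono mult_left_mono) auto
    finally show ?thesis
      using assms by (simp add: hnorm_plane plane_op_def)
  qed
  then have "\<exists>K. \<forall>x\<in>hcarrier (plane i j).
      hnorm (plane i j) (plane_op i j p q r s x) \<le> K * hnorm (plane i j) x"
    by blast
  then show ?thesis
    using assms unfolding bounded_operator_def
    by (auto simp: plane_op_def fun_eq_iff algebra_simps)
qed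

lemma selfadjoint_operator_plane_op:
  assumes "i \<noteq> j"
  shows "selfadjoint_operator (plane i j)
    (plane_op i j (complex_of_real p) (complex_of_real q) (complex_of_real q) (complex_of_real s))"
proof -
  have "cnj (complex_of_real p * u + complex_of_real q * v) * u'
      + cnj (complex_of_real q * u + complex_of_real s * v) * v' =
      cnj u * (complex_of_real p * u' + complex_of_real q * v')
      + cnj v * (complex_of_real q * u' + complex_of_real s * v')" for u v u' v'
    unfolding complex_cnj_add complex_cnj_mult complex_cnj_complex_of_real by algebra
  then show ?thesis
    using assms bounded_operator_plane_op[OF assms]
    unfolding selfadjoint_operator_def plane_simps plane_op_def by auto
qed

text \<open>If \<open>z\<close> is not a root of the characteristic polynomial, the adjugate of
  \<open>A - z\<close> divided by the determinant is a bounded two-sided inverse; \<open>w\<close>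
  in the proof is the reciprocal of that determinant.\<close>

lemma spectrum_plane_op:
  assumes "i \<noteq> j"
  shows "spectrum (plane i j) (plane_op i j p q r s) \<subseteq> {z. (p - z) * (s - z) = q * r}"
proof safe
  fix z assume z: "z \<in> spectrum (plane i j) (plane_op i j p q r s)"
  show "(p - z) * (s - z) = q * r"
  proof (rule ccontr)
    assume "\<not> ?thesis"
    then obtain w where w: "w * ((p - z) * (s - z) - q * r) = 1"
      by (metis left_inverse right_minus_eq)
    let ?R = "plane_op i j (w * (s - z)) (- w * q) (- w * r) (w * (p - z))"
    have id: "w * (s - z) * (p * u + q * v - z * u) + - w * q * (r * u + s * v - z * v) = u"
      "- w * r * (p * u + q * v - z * u) + w * (p - z) * (r * u + s * v - z * v) = v"
      "p * (w * (s - z) * u + - w * q * v) + q * (- w * r * u + w * (p - z) * v)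
         - z * (w * (s - z) * u + - w * q * v) = u"
      "r * (w * (s - z) * u + - w * q * v) + s * (- w * r * u + w * (p - z) * v)
         - z * (- w * r * u + w * (p - z) * v) = v" for u v
      using w by algebra+
    have "bounded_operator (plane i j) ?R"
      by (rule bounded_operator_plane_op[OF assms])
    moreover have "?R (hminus (plane i j) (plane_op i j p q r s x) (hscale (plane i j) z x)) = x"
      "hminus (plane i j) (plane_op i j p q r s (?R x)) (hscale (plane i j) z (?R x)) = x"
      if "x \<in> hcarrier (plane i j)" for x
      using that assms id[of "x i" "x j"] unfolding plane_simps plane_op_def mem_Collect_eq by auto
    ultimately have "z \<notin> spectrum (plane i j) (plane_op i j p q r s)"
      unfolding spectrum_def mem_Collect_eq not_not by (intro exI[of _ ?R] conjI ballI)
    then show False using z by contradiction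
  qed
qed

text \<open>Affine polynomials are enough for the functional calculus, since an operator on the
  plane has at most two spectral values.\<close>

lemma operator_poly_plane_op:
  assumes "i \<noteq> j" and "x \<in> hcarrier (plane i j)"
  shows "operator_poly (plane i j) [:c, d:] (plane_op i j p q r s) x =
    plane_op i j (c + d * p) (d * q) (d * r) (c + d * s) x"
proof -
  let ?A = "plane_op i j p q r s"
  have [simp]: "?A (\<lambda>_. 0) = (\<lambda>_. 0)"
    by (auto simp: plane_op_def)
  have step: "operator_poly (plane i j) (pCons a u) ?A y =
      (\<lambda>k. complex_of_real a * y k + ?A (operator_poly (plane i j) u ?A y) k)" for a u y
  proof (cases "a = 0 \<and> u = 0")
    \<comment> \<open>\<open>pCons 0 0\<close> is the zero polynomial, on which
      \<open>fold_coeffs\<close> performs no step; the Horner recursion is checked there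
      directly.\<close>
    case True
    then show ?thesis by (simp add: operator_poly_def)
  next
    case False
    then show ?thesis
      by (cases "u = 0") (simp_all add: operator_poly_def)
  qed
  have "operator_poly (plane i j) 0 ?A y = (\<lambda>_. 0)" for y
    by (simp add: operator_poly_def)
  then show ?thesis
    using assms by (auto simp: step plane_op_def fun_eq_iff algebra_simps)
qed

text \<open>Trace \<open>a + b\<close> and determinant \<open>a * b\<close> confine the real
  spectrum to \<open>a\<close> and \<open>b\<close>, where \<open>f\<close> agrees with
  \<open>c + d * t\<close>. The constant sequence of this affine polynomial therefore witnesses
  \<open>f(A) = c + d A\<close>.\<close>

lemma functional_calculus_plane_op:
  fixes p q s a b c d :: real
  assumes "i \<noteq> j" and tr: "p + s = a + b" and det: "p * s - q\<^sup>2 = a * b"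
    and "f a = c + d * a" "f b = c + d * b"
  shows "functional_calculus (plane i j) f
    (plane_op i j (complex_of_real p) (complex_of_real q) (complex_of_real q) (complex_of_real s))
    (plane_op i j (complex_of_real (c + d * p)) (complex_of_real (d * q)) (complex_of_real (d * q))
       (complex_of_real (c + d * s)))"
    (is "functional_calculus ?H f ?A ?T")
  unfolding functional_calculus_def
proof (intro conjI exI allI impI)
  show "bounded_operator ?H ?T"
    by (rule bounded_operator_plane_op[OF assms(1)])
  have "f t = c + d * t" if "complex_of_real t \<in> spectrum ?H ?A" for t
  proof -
    have "complex_of_real ((p - t) * (s - t)) = complex_of_real (q * q)"
      using that spectrum_plane_op[OF assms(1)] by fastforce
    then have "(p - t) * (s - t) = q * q"
      by (simp only: of_real_eq_iff)
    then have "(t - a) * (t - b) = 0"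
      using tr det by algebra
    then show ?thesis using assms(4,5) by auto
  qed
  then show "uniform_limit {t. complex_of_real t \<in> spectrum ?H ?A} (\<lambda>_. poly [:c, d:]) f sequentially"
    by (auto simp: uniform_limit_iff mult.commute)
  fix e :: real assume "e > 0"
  then show "\<forall>\<^sub>F k in sequentially. \<forall>x\<in>hcarrier ?H.
      hnorm ?H (hminus ?H (operator_poly ?H [:c, d:] ?A x) (?T x)) \<le> e * hnorm ?H x"
    using operator_poly_plane_op[OF assms(1)]
    by (auto simp: hnorm_plane simp flip: zero_prod_def intro!: always_eventually)
qed

text \<open>Completing the square after multiplication by \<open>p > 0\<close>.\<close>

lemma quadratic_form_nonneg:
  fixes p q s u v :: real
  assumes "p > 0" "p * s \<ge> q\<^sup>2"
  shows "p * u\<^sup>2 + 2 * q * (u * v) + s * v\<^sup>2 \<ge> 0"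
proof -
  have "p * (p * u\<^sup>2 + 2 * q * (u * v) + s * v\<^sup>2) = (p * u + q * v)\<^sup>2 + (p * s - q\<^sup>2) * v\<^sup>2"
    by algebra
  also have "\<dots> \<ge> 0" using assms by simp
  finally show ?thesis using assms(1) by (simp add: zero_le_mult_iff)
qed

text \<open>With real coefficients the quadratic form of a complex vector is the sum of the forms of
  its real and imaginary parts, so the order reduces to \<open>quadratic_form_nonneg\<close> for the
  difference matrix.\<close>

lemma operator_le_plane_op:
  fixes p q s p' q' s' :: real
  assumes "i \<noteq> j" "p < p'" "(p' - p) * (s' - s) \<ge> (q' - q)\<^sup>2"
  shows "operator_le (plane i j)
    (plane_op i j (complex_of_real p) (complex_of_real q) (complex_of_real q) (complex_of_real s))
    (plane_op i j (complex_of_real p') (complex_of_real q') (complex_of_real q') (complex_of_real s'))"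
proof -
  have form: "Re (hinner (plane i j) x
      (plane_op i j (complex_of_real p) (complex_of_real q) (complex_of_real q) (complex_of_real s) x)) =
      (p * (Re (x i))\<^sup>2 + 2 * q * (Re (x i) * Re (x j)) + s * (Re (x j))\<^sup>2) +
      (p * (Im (x i))\<^sup>2 + 2 * q * (Im (x i) * Im (x j)) + s * (Im (x j))\<^sup>2)" for p q s :: real and x
    using assms(1) by (simp add: plane_op_def algebra_simps power2_eq_square)
  have nn: "0 \<le> (p' - p) * u\<^sup>2 + 2 * (q' - q) * (u * v) + (s' - s) * v\<^sup>2" for u v
    using assms by (intro quadratic_form_nonneg) auto
  then have le: "p * u\<^sup>2 + 2 * q * (u * v) + s * v\<^sup>2 \<le> p' * u\<^sup>2 + 2 * q' * (u * v) + s' * v\<^sup>2" for u v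
    using nn[of u v] by (simp add: algebra_simps)
  show ?thesis
    unfolding operator_le_def form
    using assms(1) by (intro conjI selfadjoint_operator_plane_op ballI add_mono le)
qed

text \<open>Positivity is comparison with the zero operator, and 0 is not a spectral value because
  the determinant is nonzero.\<close>

lemma posdef_plane_op:
  fixes p q s :: real
  assumes "i \<noteq> j" "p > 0" "p * s > q\<^sup>2"
  shows "posdef_operator (plane i j)
    (plane_op i j (complex_of_real p) (complex_of_real q) (complex_of_real q) (complex_of_real s))"
    (is "posdef_operator ?H ?A")
proof -
  have "plane_op i j 0 0 0 0 = (\<lambda>_ _. 0)"
    by (simp add: plane_op_def fun_eq_iff)
  then have "operator_le ?H (\<lambda>x. hzero ?H) ?A"
    using operator_le_plane_op[OF assms(1), of 0 p q 0 s 0] assms by simp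
  moreover have "(complex_of_real p - 0) * (complex_of_real s - 0) \<noteq> complex_of_real q * complex_of_real q"
    using assms(3) by (auto simp: power2_eq_square simp flip: of_real_mult)
  ultimately show ?thesis
    using spectrum_plane_op[OF assms(1)] unfolding posdef_operator_def by blast
qed

text \<open>The matrix with diagonal \<open>x, a + b - x\<close> and eigenvalues \<open>a, b\<close> lies below
  \<open>diag(x + \<epsilon>, \<mu>)\<close> for large \<open>\<mu>\<close>; the upper left entries of the images under \<open>f\<close> are compared.\<close>

lemma operator_monotone_chord_le:
  fixes f :: "real \<Rightarrow> real"
  assumes f: "operator_monotone TYPE('i::infinite \<Rightarrow> complex) f"
    and a: "0 < a" "a \<le> x" "x \<le> b" "a < b" and "0 < \<epsilon>"
  shows "f a + (f b - f a) / (b - a) * (x - a) \<le> f (x + \<epsilon>)"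
proof -
  obtain i j :: 'i where ij: "i \<noteq> j"
    by (metis (full_types) UNIV_I ex_new_if_finite finite.emptyI finite_insert infinite_UNIV insert_iff)
  define s where "s = a + b - x"
  \<comment> \<open>Trace \<open>x + s = a + b\<close> and determinant
    \<open>x * s - q\<^sup>2 = a * b\<close> give the matrix \<open>A\<close> below the eigenvalues
    \<open>a\<close> and \<open>b\<close>.\<close>
  define q where "q = sqrt ((x - a) * (b - x))"
  have q2: "q\<^sup>2 = (x - a) * (b - x)"
    using a by (simp add: q_def)
  \<comment> \<open>\<open>B - A\<close> has diagonal \<open>\<epsilon>\<close>,
    \<open>\<mu> - s\<close> and off-diagonal entries \<open>- q\<close>; the summand
    \<open>q\<^sup>2 / \<epsilon>\<close> makes its determinant nonnegative, the other summands give
    \<open>\<mu> > x + \<epsilon>\<close>.\<close>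
  define \<mu> where "\<mu> = s + q\<^sup>2 / \<epsilon> + x + \<epsilon>"
  have s: "s > 0" using a by (simp add: s_def)
  then have \<mu>: "\<mu> > x + \<epsilon>" "\<mu> > 0"
    using a \<open>0 < \<epsilon>\<close> by (auto simp: \<mu>_def intro!: add_pos_nonneg)
  \<comment> \<open>\<open>d\<close> and \<open>d'\<close> are the slopes of the chords of
    \<open>f\<close> through the eigenvalues of \<open>A\<close> and of \<open>B\<close>;
    \<open>S\<close> and \<open>T\<close> are the resulting affine expressions in \<open>A\<close>
    and \<open>B\<close>.\<close>
  define d where "d = (f b - f a) / (b - a)"
  define d' where "d' = (f \<mu> - f (x + \<epsilon>)) / (\<mu> - (x + \<epsilon>))"
  define A where "A = plane_op i j (complex_of_real x) (complex_of_real q) (complex_of_real q) (complex_of_real s)"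
  define B where "B = plane_op i j (complex_of_real (x + \<epsilon>)) (complex_of_real 0) (complex_of_real 0) (complex_of_real \<mu>)"
  define S where "S = plane_op i j (complex_of_real (f a - d * a + d * x)) (complex_of_real (d * q))
    (complex_of_real (d * q)) (complex_of_real (f a - d * a + d * s))"
  define T where "T = plane_op i j (complex_of_real (f (x + \<epsilon>) - d' * (x + \<epsilon>) + d' * (x + \<epsilon>))) (complex_of_real (d' * 0))
    (complex_of_real (d' * 0)) (complex_of_real (f (x + \<epsilon>) - d' * (x + \<epsilon>) + d' * \<mu>))"
  have det: "x * s - q\<^sup>2 = a * b"
    unfolding q2 s_def by algebra
  have "posdef_operator (plane i j) A"
    unfolding A_def using a det by (intro posdef_plane_op ij) (auto simp: algebra_simps)
  moreover have "posdef_operator (plane i j) B"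
    unfolding B_def using a \<open>0 < \<epsilon>\<close> \<mu> by (intro posdef_plane_op ij) auto
  moreover have "operator_le (plane i j) A B"
    unfolding A_def B_def using a \<open>0 < \<epsilon>\<close>
    by (intro operator_le_plane_op ij) (auto simp: \<mu>_def field_simps)
  moreover have "d * (b - a) = f b - f a"
    using a by (simp add: d_def)
  then have "functional_calculus (plane i j) f A S"
    unfolding A_def S_def using det
    by (intro functional_calculus_plane_op[where a = a and b = b] ij) (auto simp: s_def algebra_simps)
  moreover have "d' * (\<mu> - (x + \<epsilon>)) = f \<mu> - f (x + \<epsilon>)"
    using \<mu> by (simp add: d'_def)
  then have "functional_calculus (plane i j) f B T"
    unfolding B_def T_def
    by (intro functional_calculus_plane_op[where a = "x + \<epsilon>" and b = \<mu>] ij) (auto simp: algebra_simps)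
  ultimately have "operator_le (plane i j) S T"
    using f hilbert_space_plane[OF ij] unfolding operator_monotone_def by blast
  then have "\<forall>z\<in>hcarrier (plane i j). Re (hinner (plane i j) z (S z)) \<le> Re (hinner (plane i j) z (T z))"
    by (simp add: operator_le_def)
  \<comment> \<open>The basis vector at \<open>i\<close> picks out the upper left entries; that of
    \<open>T\<close> equals \<open>f (x + \<epsilon>)\<close>.\<close>
  from this[rule_format, of "\<lambda>k. if k = i then 1 else 0"] ij
  have "f a - d * a + d * x \<le> f (x + \<epsilon>)"
    by (simp add: S_def T_def plane_op_def)
  then show ?thesis by (simp add: d_def[symmetric] algebra_simps)
qed

section \<open>Monotonicity, concavity and continuity of functions in \<open>F_op\<close>\<close>

lemma F_op_mono:
  assumes f: "f \<in> F_op TYPE('i::infinite \<Rightarrow> complex)" and "0 < x" "x \<le> y"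
  shows "f x \<le> f y"
proof (cases "x = y")
  case False
  \<comment> \<open>At the left endpoint \<open>x\<close> the chord has the value
    \<open>f x\<close>; any right endpoint works, here \<open>x + 1\<close>.\<close>
  then show ?thesis
    using operator_monotone_chord_le[of f x x "x + 1" "y - x"] assms by (auto simp: F_op_def)
qed simp

text \<open>Since \<open>f t / t = f (1/t)\<close>, monotonicity of \<open>f\<close> makes \<open>f t / t\<close> decreasing.\<close>

lemma F_op_add_le:
  assumes f: "f \<in> F_op TYPE('i::infinite \<Rightarrow> complex)" and "0 < x" "0 \<le> \<epsilon>"
  shows "f (x + \<epsilon>) \<le> (1 + \<epsilon> / x) * f x"
proof -
  have sym: "t * f (inverse t) = f t" if "t > 0" for t
    using f that by (simp add: F_op_def)
  have "f (x + \<epsilon>) = (x + \<epsilon>) * f (inverse (x + \<epsilon>))"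
    using assms by (simp add: sym)
  also have "\<dots> \<le> (x + \<epsilon>) * f (inverse x)"
    using assms by (intro mult_left_mono F_op_mono[OF f]) auto
  also have "\<dots> = (1 + \<epsilon> / x) * (x * f (inverse x))"
    using assms by (simp add: field_simps)
  finally show ?thesis using assms by (simp add: sym)
qed

text \<open>The chord at \<open>x\<close> lies below \<open>f (x + \<epsilon>)\<close>, which
  \<open>F_op_add_le\<close> bounds by \<open>(1 + \<epsilon> / x) * f x\<close>; letting
  \<open>\<epsilon>\<close> tend to 0 from the right yields concavity.\<close>

lemma F_op_concave_on:
  assumes f: "f \<in> F_op TYPE('i::infinite \<Rightarrow> complex)"
  shows "concave_on {0<..} f"
proof (rule concave_on_linorderI)
  fix t a b :: real
  assume t: "0 < t" "t < 1" and ab: "a \<in> {0<..}" "a < b"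
  show "f ((1 - t) *\<^sub>R a + t *\<^sub>R b) \<ge> (1 - t) * f a + t * f b"
  proof -
    define x where "x = (1 - t) * a + t * b"
    have x: "x - a = t * (b - a)" "b - x = (1 - t) * (b - a)"
      by (auto simp: x_def algebra_simps)
    have "0 \<le> x - a" "0 \<le> b - x"
      unfolding x using ab t by simp_all
    then have x': "a \<le> x" "x \<le> b" "0 < x"
      using ab by auto
    have slope: "(f b - f a) / (b - a) * (t * (b - a)) = (f b - f a) * t"
      using ab by simp
    have chord: "(1 - t) * f a + t * f b = f a + (f b - f a) / (b - a) * (x - a)"
      unfolding x slope by algebra
    have le: "(1 - t) * f a + t * f b \<le> (1 + \<epsilon> / x) * f x" if "\<epsilon> > 0" for \<epsilon>
    proof -
      have "(1 - t) * f a + t * f b \<le> f (x + \<epsilon>)"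
        unfolding chord using f ab x' that
        by (intro operator_monotone_chord_le[where 'i = 'i]) (auto simp: F_op_def)
      also have "\<dots> \<le> (1 + \<epsilon> / x) * f x"
        using F_op_add_le[OF f, of x \<epsilon>] x' that by simp
      finally show ?thesis .
    qed
    have "((\<lambda>\<epsilon>. (1 + \<epsilon> / x) * f x) \<longlongrightarrow> (1 + 0 / x) * f x) (at_right 0)"
      using x' by (intro tendsto_intros) auto
    then have "(1 - t) * f a + t * f b \<le> (1 + 0 / x) * f x"
      by (rule tendsto_lowerbound) (auto intro: le eventually_mono[OF eventually_at_right_less])
    then show ?thesis by (simp add: x_def)
  qed
qed simp

lemma F_op_continuous_on:
  assumes "f \<in> F_op TYPE('i::infinite \<Rightarrow> complex)"
  shows "continuous_on {0<..} f"
  using convex_on_continuous[of "{0<..}" "\<lambda>x. - f x"] F_op_concave_on[OF assms]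
  using continuous_on_minus[of "{0<..}" "\<lambda>x. - f x"] by (simp add: concave_on_def)

text \<open>The slope is the right derivative of \<open>f\<close> at \<open>t0\<close>, written
  through the infimum of the right difference quotients of the convex function
  \<open>- f\<close>.\<close>

lemma concave_on_supporting_line:
  fixes f :: "real \<Rightarrow> real"
  assumes "concave_on S f" "open S" "t0 \<in> S"
  obtains k where "\<And>t. t \<in> S \<Longrightarrow> f t \<le> f t0 + k * (t - t0)"
proof
  fix t assume "t \<in> S"
  then show "f t \<le> f t0 + (- Inf ((\<lambda>t. (- f t0 - - f t) / (t0 - t)) ` ({t0<..} \<inter> S))) * (t - t0)"
    using convex_le_Inf_differential[of S "\<lambda>x. - f x" t0 t] assms
    by (simp add: concave_on_def interior_open)
qed

section \<open>Hermitian matrices\<close>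

lemma madjoint_nth: "madjoint A $ i $ j = cnj (A $ j $ i)"
  by (simp add: madjoint_def transpose_def map_matrix_def)

lemma madjoint_mult: "madjoint (A ** B) = madjoint B ** madjoint A"
  by (simp add: vec_eq_iff madjoint_nth matrix_matrix_mult_def mult.commute)

lemma madjoint_madjoint [simp]: "madjoint (madjoint A) = A"
  by (simp add: vec_eq_iff madjoint_nth)

lemma madjoint_diag_mat [simp]: "madjoint (diag_mat d) = diag_mat d"
  by (simp add: vec_eq_iff madjoint_nth diag_mat_def)

lemma cinner_vec_mult_right: "cinner_vec x (A *v y) = cinner_vec (madjoint A *v x) y"
proof -
  have "cinner_vec x (A *v y) = (\<Sum>i\<in>UNIV. \<Sum>j\<in>UNIV. cnj (x $ i) * (A $ i $ j * y $ j))"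
    by (simp add: cinner_vec_def matrix_vector_mult_def sum_distrib_left)
  also have "\<dots> = (\<Sum>j\<in>UNIV. \<Sum>i\<in>UNIV. cnj (x $ i) * (A $ i $ j * y $ j))"
    by (rule sum.swap)
  also have "\<dots> = cinner_vec (madjoint A *v x) y"
    by (simp add: cinner_vec_def matrix_vector_mult_def madjoint_nth sum_distrib_left sum_distrib_right ac_simps)
  finally show ?thesis .
qed

lemma Re_cinner_vec: "Re (cinner_vec x y) = x \<bullet> y"
  by (simp add: cinner_vec_def inner_vec_def inner_complex_def)

lemma cinner_vec_commute: "cinner_vec y x = cnj (cinner_vec x y)"
  by (simp add: cinner_vec_def mult.commute)

lemma cinner_vec_self: "cinner_vec x x = complex_of_real ((norm x)\<^sup>2)"
  using cinner_vec_commute[of x x]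
  by (simp add: complex_eq_iff Re_cinner_vec power2_norm_eq_inner)

lemma cinner_vec_add_right: "cinner_vec x (y + z) = cinner_vec x y + cinner_vec x z"
  by (simp add: cinner_vec_def sum.distrib distrib_left)

lemma cinner_vec_scaleR_right: "cinner_vec x (t *\<^sub>R y) = t *\<^sub>R cinner_vec x y"
  by (simp add: cinner_vec_def scaleR_sum_right)

lemma cinner_vec_scaleR_left: "cinner_vec (t *\<^sub>R x) y = t *\<^sub>R cinner_vec x y"
  by (simp add: cinner_vec_def scaleR_sum_right)

lemma matrix_vector_mult_scaleR_complex: "(A :: complex^'n^'m) *v (t *\<^sub>R x) = t *\<^sub>R (A *v x)"
  by (simp add: vec_eq_iff matrix_vector_mult_def scaleR_sum_right)

lemma continuous_on_matrix_vector_mult_right: "continuous_on S (\<lambda>x. (A :: complex^'n^'m) *v x)"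
  unfolding matrix_vector_mult_def
  by (intro continuous_on_vec_lambda continuous_intros)

section \<open>The spectral theorem by maximising the quadratic form\<close>

lemma linear_coeff_zero_of_nonneg:
  fixes a c :: real
  assumes "\<And>t. 0 \<le> 2 * t * a + t\<^sup>2 * c" and "0 \<le> a"
  shows "a = 0"
proof (rule ccontr)
  assume "a \<noteq> 0"
  then have "a > 0" using assms by simp
  \<comment> \<open>For this \<open>t\<close> the quadratic term is at most \<open>- t * a\<close>,
    which leaves the negative bound \<open>t * a\<close> for the whole expression.\<close>
  define t where "t = - a / (\<bar>c\<bar> + 1)"
  have ta: "t * (\<bar>c\<bar> + 1) = - a" and "t < 0"
    using \<open>a > 0\<close> by (auto simp: t_def field_simps add_pos_nonneg)
  have "t\<^sup>2 * c \<le> t\<^sup>2 * (\<bar>c\<bar> + 1)"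
    by (intro mult_left_mono) auto
  also have "\<dots> = - (t * a)"
    using ta by (simp add: power2_eq_square mult.assoc)
  finally have "2 * t * a + t\<^sup>2 * c \<le> t * a" by (simp add: mult.commute)
  moreover have "t * a < 0" using \<open>t < 0\<close> \<open>a > 0\<close> by (rule mult_neg_pos)
  ultimately show False using assms(1)[of t] by linarith
qed

text \<open>The eigenvector maximises the quadratic form on the unit sphere of \<open>W\<close>; the first variation
  in direction of the residual \<open>\<lambda> x - A x\<close> vanishes.\<close>

lemma hermitian_eigenvector_orthogonal:
  fixes A :: "complex^'n^'n"
  assumes A: "madjoint A = A"
    and S: "\<And>v. v \<in> S \<Longrightarrow> \<exists>l::real. A *v v = l *\<^sub>R v"
    and y: "y \<noteq> 0" "\<And>v. v \<in> S \<Longrightarrow> cinner_vec v y = 0"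
  obtains x and l :: real where "norm x = 1" "\<And>v. v \<in> S \<Longrightarrow> cinner_vec v x = 0" "A *v x = l *\<^sub>R x"
proof -
  define W where "W = {x. \<forall>v\<in>S. cinner_vec v x = 0}"
  have "W = (\<Inter>v\<in>S. {x. cinner_vec v x = 0})"
    by (auto simp: W_def)
  then have "closed W"
    unfolding cinner_vec_def by (auto intro!: closed_Collect_eq continuous_intros)
  then have "compact (sphere 0 1 \<inter> W)"
    by (intro compact_Int_closed) auto
  moreover have "(1 / norm y) *\<^sub>R y \<in> sphere 0 1 \<inter> W"
    using y by (auto simp: W_def cinner_vec_scaleR_right)
  moreover have "continuous_on (sphere 0 1 \<inter> W) (\<lambda>x. x \<bullet> (A *v x))"
    by (intro continuous_intros continuous_on_matrix_vector_mult_right)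
  ultimately have "\<exists>x\<in>sphere 0 1 \<inter> W. \<forall>w\<in>sphere 0 1 \<inter> W. w \<bullet> (A *v w) \<le> x \<bullet> (A *v x)"
    by (intro continuous_attains_sup) blast+
  then obtain x where x: "norm x = 1" "x \<in> W"
    and max: "\<And>w. norm w = 1 \<Longrightarrow> w \<in> W \<Longrightarrow> w \<bullet> (A *v w) \<le> x \<bullet> (A *v x)"
    by auto
  define l where "l = x \<bullet> (A *v x)"
  define z where "z = l *\<^sub>R x - A *v x"
  have W_add: "u + t *\<^sub>R w \<in> W" if "u \<in> W" "w \<in> W" for u w t
    using that by (simp add: W_def cinner_vec_add_right cinner_vec_scaleR_right)
  have le: "w \<bullet> (A *v w) \<le> l * (w \<bullet> w)" if "w \<in> W" for w
  proof (cases "w = 0")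
    case False
    have "norm ((1 / norm w) *\<^sub>R w) = 1" "(1 / norm w) *\<^sub>R w \<in> W"
      using that False by (auto simp: W_def cinner_vec_scaleR_right)
    from max[OF this] show ?thesis
      using False by (simp add: matrix_vector_mult_scaleR_complex l_def field_simps
            flip: power2_norm_eq_inner power2_eq_square)
  qed simp
  \<comment> \<open>\<open>W\<close> is invariant because \<open>A\<close> is Hermitian and the
    vectors of \<open>S\<close> are eigenvectors; hence the residual \<open>z\<close> lies in
    \<open>W\<close> as well.\<close>
  have "A *v x \<in> W"
    unfolding W_def
  proof (intro CollectI ballI)
    fix v assume "v \<in> S"
    then show "cinner_vec v (A *v x) = 0"
      using S[of v] x(2) by (auto simp: cinner_vec_mult_right A W_def cinner_vec_scaleR_left)
  qed
  from W_add[OF this x(2), of "- l"] have "A *v x - l *\<^sub>R x \<in> W" by simp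
  from W_add[OF _ this, of 0 "- 1"] have "z \<in> W"
    by (simp add: z_def W_def cinner_vec_def)
  have sym: "u \<bullet> (A *v w) = (A *v u) \<bullet> w" for u w
    using cinner_vec_mult_right[of u A w] by (simp add: A flip: Re_cinner_vec)
  \<comment> \<open>The form \<open>l * (w \<bullet> w) - w \<bullet> (A *v w)\<close> is
    nonnegative on \<open>W\<close> and vanishes at \<open>x\<close>; along
    \<open>x + t *\<^sub>R z\<close> its linear coefficient in \<open>t\<close> is
    \<open>2 * (z \<bullet> z)\<close>.\<close>
  have "0 \<le> 2 * t * (z \<bullet> z) + t\<^sup>2 * (l * (z \<bullet> z) - z \<bullet> (A *v z))" for t
  proof -
    have "x \<bullet> x = 1"
      using x(1) by (simp flip: power2_norm_eq_inner)
    then have 1: "l * (x \<bullet> x) = x \<bullet> (A *v x)"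
      by (simp add: l_def)
    have 2: "z \<bullet> z = l * (x \<bullet> z) - x \<bullet> (A *v z)"
      by (simp add: sym) (simp add: z_def algebra_simps inner_simps)
    have "l * ((x + t *\<^sub>R z) \<bullet> (x + t *\<^sub>R z)) - (x + t *\<^sub>R z) \<bullet> (A *v (x + t *\<^sub>R z))
      = (l * (x \<bullet> x) - x \<bullet> (A *v x)) + 2 * t * (l * (x \<bullet> z) - x \<bullet> (A *v z))
        + t\<^sup>2 * (l * (z \<bullet> z) - z \<bullet> (A *v z))"
      using sym[of z x]
      by (simp add: matrix_vector_right_distrib matrix_vector_mult_scaleR_complex inner_simps
          inner_commute power2_eq_square algebra_simps)
    then show ?thesis
      using le[OF W_add[OF x(2) \<open>z \<in> W\<close>, of t]] 1 2 by simp
  qed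
  then have "z \<bullet> z = 0"
    by (rule linear_coeff_zero_of_nonneg) simp
  then have "A *v x = l *\<^sub>R x"
    by (simp add: z_def)
  then show thesis
    using that[of x l] x unfolding W_def by blast
qed

text \<open>The matrix whose rows are the conjugates of the vectors \<open>v i\<close>, with zero
  rows outside \<open>I\<close>, is singular; a nonzero kernel vector is the required
  \<open>y\<close>.\<close>

lemma exists_orthogonal_vector:
  fixes v :: "'n \<Rightarrow> complex^'n"
  assumes "I \<noteq> UNIV"
  obtains y where "y \<noteq> 0" "\<And>i. i \<in> I \<Longrightarrow> cinner_vec (v i) y = 0"
proof -
  define N where "N = (\<chi> i j. if i \<in> I then cnj (v i $ j) else 0)"
  obtain k where "k \<notin> I" using assms by auto
  then have "row k N = 0"
    by (simp add: N_def row_def vec_eq_iff)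
  then have "det N = 0" by (rule det_zero_row)
  then have "\<not> (\<exists>B. B ** N = mat 1)"
    by (metis invertible_det_nz invertible_left_inverse)
  then obtain y where y: "N *v y = 0" "y \<noteq> 0"
    unfolding matrix_left_invertible_ker by blast
  have "cinner_vec (v i) y = (N *v y) $ i" if "i \<in> I" for i
    using that by (simp add: N_def cinner_vec_def matrix_vector_mult_def)
  then show thesis using y that by simp
qed

text \<open>The family is built one vector at a time: as long as an index is missing, some nonzero
  vector is orthogonal to those found, and \<open>hermitian_eigenvector_orthogonal\<close> turns it
  into a further eigenvector.\<close>

lemma hermitian_eigenvectors:
  fixes A :: "complex^'n^'n"
  assumes A: "madjoint A = A" and "finite I"
  shows "\<exists>(v :: 'n \<Rightarrow> complex^'n) (d :: 'n \<Rightarrow> real). (\<forall>i\<in>I. A *v v i = d i *\<^sub>R v i) \<and>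
           (\<forall>i\<in>I. \<forall>j\<in>I. cinner_vec (v i) (v j) = (if i = j then 1 else 0))"
  using assms(2)
proof (induction I)
  case (insert k I)
  then obtain v :: "'n \<Rightarrow> complex^'n" and d :: "'n \<Rightarrow> real"
    where v: "\<And>i. i \<in> I \<Longrightarrow> A *v v i = d i *\<^sub>R v i"
      "\<And>i j. i \<in> I \<Longrightarrow> j \<in> I \<Longrightarrow> cinner_vec (v i) (v j) = (if i = j then 1 else 0)"
    by blast
  have "I \<noteq> UNIV" using insert by auto
  then obtain y where "y \<noteq> 0" "\<And>i. i \<in> I \<Longrightarrow> cinner_vec (v i) y = 0"
    by (rule exists_orthogonal_vector[where v = v]) blast
  then obtain x and l :: real where x: "norm x = 1" "\<And>w. w \<in> v ` I \<Longrightarrow> cinner_vec w x = 0"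
    "A *v x = l *\<^sub>R x"
    by (rule_tac hermitian_eigenvector_orthogonal[OF A, of "v ` I" y]) (use v in blast)+
  have "cinner_vec x x = 1" "\<And>i. i \<in> I \<Longrightarrow> cinner_vec x (v i) = 0"
    using x by (auto simp: cinner_vec_self cinner_vec_commute[of x])
  then have "(\<forall>i\<in>insert k I. A *v (v(k := x)) i = (d(k := l)) i *\<^sub>R (v(k := x)) i) \<and>
      (\<forall>i\<in>insert k I. \<forall>j\<in>insert k I.
        cinner_vec ((v(k := x)) i) ((v(k := x)) j) = (if i = j then 1 else 0))"
    using insert.hyps v x by auto
  then show ?case by blast
qed auto

section \<open>Diagonalisation and the functional calculus of Hermitian matrices\<close>

lemma diag_mat_mult_right_nth: "(A ** diag_mat d) $ i $ j = A $ i $ j * complex_of_real (d j)"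
  by (simp add: matrix_matrix_mult_def diag_mat_def if_distrib[where f = "\<lambda>x. _ * x"] cong: if_cong)

lemma diag_mat_mult_left_nth: "(diag_mat d ** A) $ i $ j = complex_of_real (d i) * A $ i $ j"
  by (simp add: matrix_matrix_mult_def diag_mat_def if_distrib[where f = "\<lambda>x. x * _"] cong: if_cong)

lemma diag_mat_mult: "diag_mat c ** diag_mat d = diag_mat (\<lambda>i. c i * d i)"
  by (simp add: vec_eq_iff diag_mat_mult_left_nth) (simp add: diag_mat_def)

lemma diag_mat_one: "diag_mat (\<lambda>_. 1) = mat 1"
  by (simp add: vec_eq_iff diag_mat_def mat_def)

lemma unitary_cancel:
  assumes "unitary U"
  shows "madjoint U ** (U ** X) = X" "U ** (madjoint U ** X) = X"
  using assms by (simp_all add: unitary_def matrix_mul_assoc)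

text \<open>An orthonormal family of eigenvectors indexed by the whole type supplies the columns of
  \<open>U\<close>.\<close>

theorem spectral_decomposition:
  fixes A :: "complex^'n^'n"
  assumes "madjoint A = A"
  obtains U d where "unitary U" "A = U ** diag_mat d ** madjoint U"
proof -
  obtain v :: "'n \<Rightarrow> complex^'n" and d :: "'n \<Rightarrow> real"
    where v: "\<And>i. A *v v i = d i *\<^sub>R v i"
      "\<And>i j. cinner_vec (v i) (v j) = (if i = j then 1 else 0)"
    using hermitian_eigenvectors[OF assms finite[of UNIV]] by auto
  define U :: "complex^'n^'n" where "U = (\<chi> i j. v j $ i)"
  have "(madjoint U ** U) $ i $ j = cinner_vec (v i) (v j)" for i j
    by (simp add: matrix_matrix_mult_def madjoint_nth U_def cinner_vec_def)
  then have "madjoint U ** U = mat 1"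
    by (simp add: vec_eq_iff v mat_def)
  then have U: "unitary U"
    using matrix_left_right_inverse unfolding unitary_def by blast
  have "(A ** U) $ i $ j = (A *v v j) $ i" for i j
    by (simp add: matrix_matrix_mult_def matrix_vector_mult_def U_def)
  then have "A ** U = U ** diag_mat d"
    by (simp add: vec_eq_iff v diag_mat_mult_right_nth) (simp add: U_def scaleR_conv_of_real)
  then have "A = U ** diag_mat d ** madjoint U"
    using U by (metis matrix_mul_assoc matrix_mul_rid unitary_def)
  with U show thesis by (rule that)
qed

text \<open>The change of basis \<open>W\<close> satisfies
  \<open>W $ i $ j * d j = e i * W $ i $ j\<close>, so its entries vanish unless
  \<open>d j = e i\<close>. It therefore intertwines the diagonal matrices of
  \<open>f \<circ> d\<close> and \<open>f \<circ> e\<close> too.\<close>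

lemma mat_fun_unique:
  assumes U: "unitary U" and V: "unitary V"
    and eq: "U ** diag_mat d ** madjoint U = V ** diag_mat e ** madjoint V"
  shows "U ** diag_mat (f \<circ> d) ** madjoint U = V ** diag_mat (f \<circ> e) ** madjoint V"
proof -
  define W where "W = madjoint V ** U"
  have "W ** diag_mat d = madjoint V ** (U ** diag_mat d ** madjoint U) ** U"
    using U by (simp add: W_def unitary_def unitary_cancel flip: matrix_mul_assoc)
  also have "\<dots> = diag_mat e ** W"
    unfolding eq using V by (simp add: W_def unitary_cancel flip: matrix_mul_assoc)
  finally have "W $ i $ j * complex_of_real (d j) = complex_of_real (e i) * W $ i $ j" for i j
    by (metis diag_mat_mult_left_nth diag_mat_mult_right_nth)
  then have "W $ i $ j = 0 \<or> d j = e i" for i j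
    by (metis mult.commute mult_cancel_left of_real_eq_iff)
  then have W: "W ** diag_mat (f \<circ> d) = diag_mat (f \<circ> e) ** W"
    by (auto simp: vec_eq_iff diag_mat_mult_left_nth diag_mat_mult_right_nth) metis
  have "U ** diag_mat (f \<circ> d) ** madjoint U = V ** (W ** diag_mat (f \<circ> d)) ** madjoint U"
    using V by (simp add: W_def unitary_cancel flip: matrix_mul_assoc)
  also have "\<dots> = V ** diag_mat (f \<circ> e) ** madjoint V"
    unfolding W using U by (simp add: W_def unitary_def flip: matrix_mul_assoc)
  finally show ?thesis .
qed

text \<open>By \<open>mat_fun_unique\<close> the definite description has exactly one solution, so
  any diagonalisation may be used to evaluate it.\<close>

lemma mat_fun_eq:
  assumes "unitary U"
  shows "mat_fun f (U ** diag_mat d ** madjoint U) = U ** diag_mat (f \<circ> d) ** madjoint U"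
  unfolding mat_fun_def
proof (rule the_equality)
  let ?A = "U ** diag_mat d ** madjoint U"
  show "\<exists>V e. unitary V \<and> ?A = V ** diag_mat e ** madjoint V \<and>
      U ** diag_mat (f \<circ> d) ** madjoint U = V ** diag_mat (f \<circ> e) ** madjoint V"
    using assms by (intro exI[of _ U] exI[of _ d]) simp
  fix S assume "\<exists>V e. unitary V \<and> ?A = V ** diag_mat e ** madjoint V \<and>
      S = V ** diag_mat (f \<circ> e) ** madjoint V"
  then obtain V e where V: "unitary V" "?A = V ** diag_mat e ** madjoint V"
    and S: "S = V ** diag_mat (f \<circ> e) ** madjoint V"
    by (elim exE conjE)
  show "S = U ** diag_mat (f \<circ> d) ** madjoint U"
    unfolding S by (rule mat_fun_unique[OF assms V, symmetric])
qed

section \<open>Positive definite matrices: congruence, traces and square roots\<close>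

lemma matrix_vector_mult_axis_nth: "((A :: complex^'n^'m) *v axis j 1) $ i = A $ i $ j"
  by (simp add: matrix_vector_mult_def axis_def if_distrib[where f = "\<lambda>x. _ * x"] cong: if_cong)

lemma cinner_vec_axis: "cinner_vec (axis j 1) x = x $ j"
  by (simp add: cinner_vec_def axis_def if_distrib[where f = "\<lambda>x. x * _"]
      if_distrib[where f = cnj] cong: if_cong)

lemma possemidef_congruence:
  assumes "possemidef A"
  shows "possemidef (madjoint L ** A ** L)"
proof -
  have "cinner_vec x ((madjoint L ** A ** L) *v x) = cinner_vec (L *v x) (A *v (L *v x))" for x
    by (simp add: cinner_vec_mult_right[of x "madjoint L"] flip: matrix_vector_mul_assoc matrix_mul_assoc)
  then show ?thesis
    using assms by (simp add: possemidef_def madjoint_mult matrix_mul_assoc)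
qed

text \<open>The left inverse \<open>R\<close> keeps \<open>L *v x\<close> nonzero for nonzero
  \<open>x\<close>, which preserves strict positivity.\<close>

lemma posdef_congruence:
  assumes "posdef A" and "R ** L = mat 1"
  shows "posdef (madjoint L ** A ** L)"
proof -
  have "cinner_vec x ((madjoint L ** A ** L) *v x) = cinner_vec (L *v x) (A *v (L *v x))" for x
    by (simp add: cinner_vec_mult_right[of x "madjoint L"] flip: matrix_vector_mul_assoc matrix_mul_assoc)
  moreover have "L *v x \<noteq> 0" if "x \<noteq> 0" for x
    using that assms(2) by (metis matrix_vector_mul_assoc matrix_vector_mul_lid matrix_vector_mult_0_right)
  ultimately show ?thesis
    using assms(1) by (simp add: posdef_def madjoint_mult matrix_mul_assoc)
qed

lemma possemidef_diag:
  assumes "possemidef A"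
  shows "A $ j $ j = complex_of_real (Re (A $ j $ j))" "0 \<le> Re (A $ j $ j)"
proof -
  have "madjoint A $ j $ j = A $ j $ j" "Re (cinner_vec (axis j 1) (A *v axis j 1)) \<ge> 0"
    using assms by (simp_all add: possemidef_def)
  then show "A $ j $ j = complex_of_real (Re (A $ j $ j))" "0 \<le> Re (A $ j $ j)"
    by (simp_all add: madjoint_nth cinner_vec_axis matrix_vector_mult_axis_nth complex_eq_iff)
qed

lemma posdef_diag: "posdef A \<Longrightarrow> 0 < Re (A $ j $ j)"
  unfolding posdef_def
  using cinner_vec_axis[of j "A *v axis j 1"] matrix_vector_mult_axis_nth[of A j j]
  by (metis axis_eq_0_iff zero_neq_one)

text \<open>The eigenvalues are the diagonal entries of \<open>madjoint U ** A ** U\<close>, which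
  is positive definite by congruence.\<close>

lemma spectral_decomposition_posdef:
  assumes "posdef A"
  obtains U d where "unitary U" "A = U ** diag_mat d ** madjoint U" "\<And>i. 0 < d i"
proof -
  obtain U d where U: "unitary U" and A: "A = U ** diag_mat d ** madjoint U"
    using assms spectral_decomposition unfolding posdef_def by blast
  have "diag_mat d = madjoint U ** A ** U"
    using U by (simp add: A unitary_def unitary_cancel flip: matrix_mul_assoc)
  then have "posdef (diag_mat d)"
    using U posdef_congruence[OF assms, of "madjoint U" U] by (simp add: unitary_def)
  then have "0 < d i" for i
    using posdef_diag[of "diag_mat d" i] by (simp add: diag_mat_def)
  then show thesis using that U A by blast
qed

text \<open>Cyclicity of the trace leaves only the diagonal of \<open>madjoint V ** P ** V\<close>,
  whose entries act as weights.\<close>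

lemma trace_mult_diag:
  "trace (P ** (V ** diag_mat d ** madjoint V)) =
    (\<Sum>j\<in>UNIV. complex_of_real (d j) * (madjoint V ** P ** V) $ j $ j)"
proof -
  have "trace (P ** (V ** diag_mat d ** madjoint V)) = trace (madjoint V ** (P ** (V ** diag_mat d)))"
    by (subst trace_mul_sym) (simp add: matrix_mul_assoc)
  also have "\<dots> = trace (madjoint V ** P ** V ** diag_mat d)"
    by (simp add: matrix_mul_assoc)
  finally show ?thesis
    by (simp add: trace_def diag_mat_mult_right_nth mult.commute)
qed

text \<open>In an eigenbasis of \<open>A\<close> the trace is a sum of positive eigenvalues with
  nonnegative weights that add up to \<open>trace \<rho> = 1\<close>, so at least one weight is
  positive.\<close>

lemma trace_mult_posdef_pos:
  assumes "possemidef \<rho>" "trace \<rho> = 1" "posdef A"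
  shows "0 < Re (trace (\<rho> ** A))"
proof -
  obtain U d where U: "unitary U" and A: "A = U ** diag_mat d ** madjoint U" and d: "\<And>i. 0 < d i"
    using spectral_decomposition_posdef[OF assms(3)] by blast
  let ?w = "\<lambda>j. Re ((madjoint U ** \<rho> ** U) $ j $ j)"
  have w: "0 \<le> ?w j" for j
    using possemidef_diag(2)[OF possemidef_congruence[OF assms(1)]] .
  have "trace \<rho> = trace (\<rho> ** (U ** diag_mat (\<lambda>_. 1) ** madjoint U))"
    using U by (simp add: diag_mat_one unitary_def)
  then have "(\<Sum>j\<in>UNIV. ?w j) = 1"
    using assms(2) by (simp add: trace_mult_diag complex_eq_iff)
  then obtain j where "?w j \<noteq> 0"
    by (metis (no_types, lifting) sum.neutral zero_neq_one)
  then have "0 < d j * ?w j"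
    using w[of j] d[of j] by simp
  then have "0 < (\<Sum>j\<in>UNIV. d j * ?w j)"
    using w d by (intro sum_pos2[of UNIV j]) (auto simp: less_imp_le intro!: mult_nonneg_nonneg)
  then show ?thesis
    by (simp add: A trace_mult_diag)
qed

lemma posdef_sqrt:
  fixes A :: "complex^'n^'n"
  assumes "posdef A"
  defines "R \<equiv> mat_fun (\<lambda>t. t powr (1/2)) A" and "Q \<equiv> mat_fun (\<lambda>t. t powr (- (1/2))) A"
  shows "madjoint R = R" "madjoint Q = Q" "R ** R = A" "R ** Q = mat 1" "Q ** R = mat 1"
proof -
  obtain U d where U: "unitary U" and A: "A = U ** diag_mat d ** madjoint U" and d: "\<And>i. 0 < d i"
    using spectral_decomposition_posdef[OF assms(1)] by blast
  have R: "R = U ** diag_mat ((\<lambda>t. t powr (1/2)) \<circ> d) ** madjoint U"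
    and Q: "Q = U ** diag_mat ((\<lambda>t. t powr (- (1/2))) \<circ> d) ** madjoint U"
    unfolding A R_def Q_def using U by (rule mat_fun_eq)+
  show "madjoint R = R" "madjoint Q = Q"
    by (simp_all add: R Q madjoint_mult matrix_mul_assoc)
  have "U ** diag_mat g ** madjoint U ** (U ** diag_mat h ** madjoint U) =
      U ** diag_mat (\<lambda>i. g i * h i) ** madjoint U" for g h
    using U by (simp add: unitary_cancel flip: matrix_mul_assoc diag_mat_mult)
  then show "R ** R = A" "R ** Q = mat 1" "Q ** R = mat 1"
    using U d by (simp_all add: R Q A less_imp_le less_imp_neq[symmetric]
        diag_mat_one unitary_def flip: powr_add)
qed

text \<open>\<open>c\<close> lists the eigenvalues of \<open>Q ** B ** Q\<close>, and
  \<open>w\<close> the diagonal of \<open>R ** \<rho> ** R\<close> in a corresponding eigenbasis,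
  where \<open>R\<close> and \<open>Q\<close> are the powers of \<open>A\<close> with exponents 1/2
  and -1/2. Neither depends on \<open>f\<close>: the constant 1, the identity and \<open>f\<close>
  applied to \<open>Q ** B ** Q\<close> give the three traces.\<close>

lemma matrix_mean_trace:
  fixes A B \<rho> :: "complex^'n^'n"
  assumes "possemidef \<rho>" "posdef A" "posdef B"
  obtains w c :: "'n \<Rightarrow> real" where
    "\<And>j. 0 \<le> w j" "\<And>j. 0 < c j"
    "trace (\<rho> ** A) = complex_of_real (\<Sum>j\<in>UNIV. w j)"
    "trace (\<rho> ** B) = complex_of_real (\<Sum>j\<in>UNIV. w j * c j)"
    "\<And>f. trace (\<rho> ** matrix_mean f A B) = complex_of_real (\<Sum>j\<in>UNIV. w j * f (c j))"
proof -
  let ?R = "mat_fun (\<lambda>t. t powr (1/2)) A" and ?Q = "mat_fun (\<lambda>t. t powr (- (1/2))) A"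
  obtain R Q where R: "?R = R" and Q: "?Q = Q" by blast
  note sqrt = posdef_sqrt[OF assms(2), unfolded R Q]
  have "posdef (Q ** B ** Q)"
    using posdef_congruence[OF assms(3) sqrt(4)] by (simp add: sqrt)
  then obtain V c where V: "unitary V" and C: "Q ** B ** Q = V ** diag_mat c ** madjoint V"
    and c: "\<And>i. 0 < c i"
    using spectral_decomposition_posdef by blast
  define w where "w j = Re ((madjoint V ** (R ** \<rho> ** R) ** V) $ j $ j)" for j
  have w: "0 \<le> w j" "(madjoint V ** (R ** \<rho> ** R) ** V) $ j $ j = complex_of_real (w j)" for j
    using possemidef_diag[OF possemidef_congruence[OF possemidef_congruence[OF assms(1), of R], of V], of j]
    by (simp_all add: sqrt w_def)
  have tr: "trace (\<rho> ** (R ** (V ** diag_mat g ** madjoint V) ** R)) =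
      complex_of_real (\<Sum>j\<in>UNIV. w j * g j)" for g
  proof -
    have "trace (\<rho> ** (R ** (V ** diag_mat g ** madjoint V) ** R)) =
        trace (R ** (\<rho> ** R ** (V ** diag_mat g ** madjoint V)))"
      by (subst trace_mul_sym) (simp add: matrix_mul_assoc)
    also have "\<dots> = trace ((R ** \<rho> ** R) ** (V ** diag_mat g ** madjoint V))"
      by (simp add: matrix_mul_assoc)
    finally show ?thesis
      by (simp add: trace_mult_diag w mult.commute)
  qed
  show thesis
  proof (rule that[of w c])
    show "trace (\<rho> ** A) = complex_of_real (\<Sum>j\<in>UNIV. w j)"
      using tr[of "\<lambda>_. 1"] V by (simp add: diag_mat_one unitary_def sqrt)
    \<comment> \<open>\<open>Q\<close> is inverse to \<open>R\<close>, so the outer factors cancel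
      and \<open>B\<close> is recovered.\<close>
    have "R ** (Q ** B ** Q) ** R = (R ** Q) ** B ** (Q ** R)"
      by (simp add: matrix_mul_assoc)
    then show "trace (\<rho> ** B) = complex_of_real (\<Sum>j\<in>UNIV. w j * c j)"
      using tr[of c] by (simp add: sqrt flip: C)
    show "trace (\<rho> ** matrix_mean f A B) = complex_of_real (\<Sum>j\<in>UNIV. w j * f (c j))" for f
      using tr[of "f \<circ> c"] assms by (simp add: matrix_mean_def R Q Let_def C mat_fun_eq[OF V])
  qed (use w c in auto)
qed

section \<open>Measurability\<close>

lemma continuous_on_matrix_mult:
  fixes F :: "'a::topological_space \<Rightarrow> complex^'n^'m" and G :: "'a \<Rightarrow> complex^'k^'n"
  assumes "continuous_on S F" "continuous_on S G"
  shows "continuous_on S (\<lambda>x. F x ** G x)"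
  unfolding matrix_matrix_mult_def using assms
  by (intro continuous_on_vec_lambda continuous_intros)

lemma tendsto_matrix_mult:
  fixes F :: "'a \<Rightarrow> complex^'n^'m" and G :: "'a \<Rightarrow> complex^'k^'n"
  assumes "(F \<longlongrightarrow> A) net" "(G \<longlongrightarrow> B) net"
  shows "((\<lambda>x. F x ** G x) \<longlongrightarrow> A ** B) net"
  unfolding matrix_matrix_mult_def using assms
  by (intro tendsto_vec_lambda tendsto_intros)

lemma borel_measurable_matrix_mult [measurable]:
  fixes F :: "'a \<Rightarrow> complex^'n^'m" and G :: "'a \<Rightarrow> complex^'k^'n"
  assumes "F \<in> borel_measurable M" "G \<in> borel_measurable M"
  shows "(\<lambda>x. F x ** G x) \<in> borel_measurable M"
  by (rule borel_measurable_continuous_Pair[OF assms])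
    (intro continuous_on_matrix_mult continuous_intros)

lemma borel_measurable_trace [measurable]:
  "(trace :: complex^'n^'n \<Rightarrow> complex) \<in> borel_measurable borel"
  unfolding trace_def
  by (intro borel_measurable_continuous_onI continuous_intros)

text \<open>The form of a positive definite matrix attains a positive minimum on the compact unit
  sphere. The lower bounds \<open>1 / (n + 1)\<close> exhibit the positive definite matrices as a
  countable union of closed sets, hence as a Borel set.\<close>

lemma posdef_iff_uniform:
  fixes A :: "complex^'n^'n"
  shows "posdef A \<longleftrightarrow> madjoint A = A \<and> (\<exists>n. \<forall>x. inverse (real (Suc n)) * (x \<bullet> x) \<le> x \<bullet> (A *v x))"
proof (intro iffI conjI; (elim conjE exE)?)
  assume A: "posdef A"
  then show "madjoint A = A" by (simp add: posdef_def)
  have "axis undefined 1 \<in> (sphere 0 1 :: (complex^'n) set)"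
    by (simp add: norm_axis_1)
  then have "\<exists>x\<in>sphere 0 1. \<forall>y\<in>sphere 0 1. x \<bullet> (A *v x) \<le> y \<bullet> (A *v y)"
    by (intro continuous_attains_inf continuous_intros continuous_on_matrix_vector_mult_right
        compact_sphere) blast
  then obtain z where z: "norm z = 1" "\<And>y. norm y = 1 \<Longrightarrow> z \<bullet> (A *v z) \<le> y \<bullet> (A *v y)"
    by auto
  from z(1) have "0 < z \<bullet> (A *v z)"
    using A norm_zero zero_neq_one unfolding posdef_def Re_cinner_vec by metis
  then obtain n where n: "inverse (real (Suc n)) < z \<bullet> (A *v z)"
    using reals_Archimedean by blast
  have "inverse (real (Suc n)) * (x \<bullet> x) \<le> x \<bullet> (A *v x)" for x
  proof (cases "x = 0")
    case False
    have "z \<bullet> (A *v z) * (x \<bullet> x) \<le> x \<bullet> (A *v x)"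
      using z(2)[of "(1 / norm x) *\<^sub>R x"] False
      by (simp add: matrix_vector_mult_scaleR_complex field_simps
          flip: power2_norm_eq_inner power2_eq_square)
    moreover have "inverse (real (Suc n)) * (x \<bullet> x) \<le> z \<bullet> (A *v z) * (x \<bullet> x)"
      using n by (intro mult_right_mono) auto
    ultimately show ?thesis by linarith
  qed simp
  then show "\<exists>n. \<forall>x. inverse (real (Suc n)) * (x \<bullet> x) \<le> x \<bullet> (A *v x)" by blast
next
  fix n assume "madjoint A = A" and n: "\<forall>x. inverse (real (Suc n)) * (x \<bullet> x) \<le> x \<bullet> (A *v x)"
  moreover have "0 < x \<bullet> (A *v x)" if "x \<noteq> 0" for x
  proof -
    have "0 < inverse (real (Suc n)) * (x \<bullet> x)"
      using that by simp
    then show ?thesis using n order_less_le_trans by blast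
  qed
  ultimately show "posdef A" by (simp add: posdef_def Re_cinner_vec)
qed

lemma posdef_borel [measurable]: "Measurable.pred borel (posdef :: complex^'n^'n \<Rightarrow> bool)"
proof -
  have "{A :: complex^'n^'n. madjoint A = A} \<in> sets borel"
    unfolding madjoint_def transpose_def map_matrix_def
    by (intro borel_closed closed_Collect_eq continuous_on_vec_lambda continuous_intros)
  moreover have "{A :: complex^'n^'n. \<forall>x. inverse (real (Suc n)) * (x \<bullet> x) \<le> x \<bullet> (A *v x)} \<in> sets borel" for n
    unfolding matrix_vector_mult_def
    by (intro borel_closed closed_Collect_all closed_Collect_le continuous_on_vec_lambda continuous_intros) auto
  ultimately have "{A. madjoint A = A} \<inter>
      (\<Union>n. {A :: complex^'n^'n. \<forall>x. inverse (real (Suc n)) * (x \<bullet> x) \<le> x \<bullet> (A *v x)}) \<in> sets borel"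
    by (intro sets.Int sets.countable_UN) auto
  then have "{A :: complex^'n^'n. posdef A} \<in> sets borel"
    by (simp add: posdef_iff_uniform Collect_conj_eq Collect_ex_eq)
  then show ?thesis by (simp add: pred_def)
qed

section \<open>Measurability of the functional calculus and of the matrix mean\<close>

lemma scaleR_matrix_mult_left: "(c *\<^sub>R A) ** (B :: complex^'k^'n) = c *\<^sub>R (A ** B)"
  by (simp add: vec_eq_iff matrix_matrix_mult_def scaleR_sum_right)

lemma scaleR_matrix_mult_right: "A ** (c *\<^sub>R (B :: complex^'k^'n)) = c *\<^sub>R (A ** B)"
  by (simp add: vec_eq_iff matrix_matrix_mult_def scaleR_sum_right)

lemma matrix_add_mult_distrib: "(A + B) ** (C :: complex^'k^'n) = A ** C + B ** C"
  by (simp add: vec_eq_iff matrix_matrix_mult_def distrib_right sum.distrib)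

text \<open>Following the construction of the polynomial gives a continuous map on all matrices that
  agrees with the functional calculus on Hermitian ones; such maps serve to approximate
  \<open>mat_fun\<close>.\<close>

lemma real_polynomial_function_matrix:
  assumes "real_polynomial_function p"
  shows "\<exists>F :: complex^'n^'n \<Rightarrow> complex^'n^'n. continuous_on UNIV F \<and>
    (\<forall>U d. unitary U \<longrightarrow>
      F (U ** diag_mat d ** madjoint U) = U ** diag_mat (p \<circ> d) ** madjoint U)"
  using assms
proof (induction p rule: real_polynomial_function.induct)
  case (linear p)
  then obtain c where p: "p = (\<lambda>t. t * c)" using real_bounded_linear by blast
  have "diag_mat (p \<circ> d) = c *\<^sub>R diag_mat d" for d :: "'n \<Rightarrow> real"
    by (simp add: vec_eq_iff diag_mat_def p) (simp add: scaleR_conv_of_real mult.commute)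
  then have "c *\<^sub>R (U ** diag_mat d ** madjoint U) = U ** diag_mat (p \<circ> d) ** madjoint U"
    for U :: "complex^'n^'n" and d
    by (simp add: scaleR_matrix_mult_left scaleR_matrix_mult_right)
  then show ?case
    by (intro exI[of _ "\<lambda>A. c *\<^sub>R A"]) (auto simp: comp_def intro!: continuous_intros)
next
  case (const c)
  have "c *\<^sub>R mat 1 = U ** diag_mat ((\<lambda>_. c) \<circ> d) ** madjoint U"
    if "unitary U" for U :: "complex^'n^'n" and d :: "'n \<Rightarrow> real"
  proof -
    have "U ** diag_mat ((\<lambda>_. c) \<circ> d) = c *\<^sub>R U"
      by (simp add: vec_eq_iff diag_mat_mult_right_nth) (simp add: scaleR_conv_of_real mult.commute)
    then show ?thesis
      using that by (simp add: unitary_def scaleR_matrix_mult_left)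
  qed
  then show ?case
    by (intro exI[of _ "\<lambda>_. c *\<^sub>R mat 1"]) (auto intro!: continuous_intros)
next
  case (add p q)
  then obtain F G where "continuous_on UNIV F" "continuous_on UNIV G"
    and FG: "\<And>(U :: complex^'n^'n) d. unitary U \<Longrightarrow>
        F (U ** diag_mat d ** madjoint U) = U ** diag_mat (p \<circ> d) ** madjoint U"
      "\<And>(U :: complex^'n^'n) d. unitary U \<Longrightarrow>
        G (U ** diag_mat d ** madjoint U) = U ** diag_mat (q \<circ> d) ** madjoint U"
    by blast
  moreover have "diag_mat ((\<lambda>t. p t + q t) \<circ> d) = diag_mat (p \<circ> d) + diag_mat (q \<circ> d)"
    for d :: "'n \<Rightarrow> real"
    by (simp add: vec_eq_iff diag_mat_def)
  ultimately show ?case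
    by (intro exI[of _ "\<lambda>A. F A + G A"])
      (auto intro!: continuous_intros simp: comp_def matrix_add_ldistrib matrix_add_mult_distrib)
next
  case (mult p q)
  then obtain F G where "continuous_on UNIV F" "continuous_on UNIV G"
    and FG: "\<And>(U :: complex^'n^'n) d. unitary U \<Longrightarrow>
        F (U ** diag_mat d ** madjoint U) = U ** diag_mat (p \<circ> d) ** madjoint U"
      "\<And>(U :: complex^'n^'n) d. unitary U \<Longrightarrow>
        G (U ** diag_mat d ** madjoint U) = U ** diag_mat (q \<circ> d) ** madjoint U"
    by blast
  moreover have "diag_mat ((\<lambda>t. p t * q t) \<circ> d) = diag_mat (p \<circ> d) ** diag_mat (q \<circ> d)"
    for d :: "'n \<Rightarrow> real"
    by (simp add: diag_mat_mult comp_def)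
  ultimately show ?case
    by (intro exI[of _ "\<lambda>A. F A ** G A"])
      (auto intro!: continuous_on_matrix_mult simp: comp_def unitary_cancel simp flip: matrix_mul_assoc)
qed

text \<open>Weierstrass approximation within \<open>1 / (k + 1)\<close> on the interval from
  \<open>1 / (k + 1)\<close> to \<open>k\<close>; each \<open>t > 0\<close> lies in all but finitely
  many of these intervals.\<close>

lemma real_polynomial_function_limit:
  fixes f :: "real \<Rightarrow> real"
  assumes "continuous_on {0<..} f"
  obtains p where "\<And>k. real_polynomial_function (p k)" "\<And>t. 0 < t \<Longrightarrow> (\<lambda>k. p k t) \<longlonglongrightarrow> f t"
proof -
  have "\<exists>g. real_polynomial_function g \<and>
      (\<forall>x\<in>{inverse (real (Suc k))..real k}. \<bar>f x - g x\<bar> < inverse (real (Suc k)))" for k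
  proof -
    have "continuous_on {inverse (real (Suc k))..real k} f"
      by (rule continuous_on_subset[OF assms]) (auto intro: less_le_trans[rotated])
    then show ?thesis
      by (rule Stone_Weierstrass_real_polynomial_function[OF compact_Icc, of _ _ _ "inverse (real (Suc k))"]) auto
  qed
  then obtain p where p: "\<And>k. real_polynomial_function (p k)"
    "\<And>k x. inverse (real (Suc k)) \<le> x \<Longrightarrow> x \<le> real k \<Longrightarrow> \<bar>f x - p k x\<bar> < inverse (real (Suc k))"
    by (metis atLeastAtMost_iff)
  have "(\<lambda>k. p k t) \<longlonglongrightarrow> f t" if "0 < t" for t
  proof -
    have "\<forall>\<^sub>F k in sequentially. inverse (real (Suc k)) < t"
      using order_tendstoD(2)[OF LIMSEQ_inverse_real_of_nat that] .
    moreover have "\<forall>\<^sub>F k in sequentially. t \<le> real k"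
      using filterlim_real_sequentially unfolding filterlim_at_top by blast
    ultimately have "\<forall>\<^sub>F k in sequentially. norm (p k t - f t) \<le> inverse (real (Suc k))"
      by eventually_elim (use p(2) in \<open>force simp: abs_minus_commute intro: less_imp_le\<close>)
    then have "(\<lambda>k. p k t - f t) \<longlonglongrightarrow> 0"
      by (rule Lim_null_comparison[OF _ LIMSEQ_inverse_real_of_nat])
    then show ?thesis by (rule LIM_zero_cancel)
  qed
  then show thesis using that p(1) by blast
qed

text \<open>On positive definite matrices \<open>mat_fun f\<close> is the pointwise limit of the
  continuous maps attached to approximating polynomials; the default 0 is taken off a Borel
  set.\<close>

lemma borel_measurable_mat_fun:
  fixes Z :: "'a \<Rightarrow> complex^'n^'n"
  assumes f: "continuous_on {0<..} f" and [measurable]: "Z \<in> borel_measurable M"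
  shows "(\<lambda>x. if posdef (Z x) then mat_fun f (Z x) else 0) \<in> borel_measurable M"
proof -
  obtain p where p: "\<And>k. real_polynomial_function (p k)" "\<And>t. 0 < t \<Longrightarrow> (\<lambda>k. p k t) \<longlonglongrightarrow> f t"
    using real_polynomial_function_limit[OF f] by blast
  have "\<forall>k. \<exists>F :: complex^'n^'n \<Rightarrow> complex^'n^'n. continuous_on UNIV F \<and>
    (\<forall>U d. unitary U \<longrightarrow>
      F (U ** diag_mat d ** madjoint U) = U ** diag_mat (p k \<circ> d) ** madjoint U)"
    using real_polynomial_function_matrix[OF p(1)] by (rule allI)
  from choice[OF this]
  obtain F :: "nat \<Rightarrow> complex^'n^'n \<Rightarrow> complex^'n^'n" where "\<And>k. continuous_on UNIV (F k)"
    and F: "\<And>k U d. unitary U \<Longrightarrow>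
      F k (U ** diag_mat d ** madjoint U) = U ** diag_mat (p k \<circ> d) ** madjoint U"
    by blast
  then have [measurable]: "F k \<in> borel_measurable borel" for k
    by (intro borel_measurable_continuous_onI)
  have lim: "(\<lambda>k. F k A) \<longlonglongrightarrow> mat_fun f A" if pd: "posdef A" for A
  proof -
    obtain U d where U: "unitary U" and A: "A = U ** diag_mat d ** madjoint U" and "\<And>i. 0 < d i"
      using spectral_decomposition_posdef[OF pd] by blast
    then have "(\<lambda>k. if i = j then complex_of_real ((p k \<circ> d) i) else 0)
        \<longlonglongrightarrow> (if i = j then complex_of_real ((f \<circ> d) i) else 0)" for i j
      by (auto intro!: tendsto_intros p(2))
    then have "(\<lambda>k. diag_mat (p k \<circ> d)) \<longlonglongrightarrow> diag_mat (f \<circ> d)"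
      unfolding diag_mat_def by (intro tendsto_vec_lambda)
    then show ?thesis
      unfolding A F[OF U] mat_fun_eq[OF U] by (intro tendsto_matrix_mult tendsto_const)
  qed
  show ?thesis
  proof (rule borel_measurable_LIMSEQ_metric)
    show "(\<lambda>x. if posdef (Z x) then F k (Z x) else 0) \<in> borel_measurable M" for k
      by measurable
    show "(\<lambda>k. if posdef (Z x) then F k (Z x) else 0)
        \<longlonglongrightarrow> (if posdef (Z x) then mat_fun f (Z x) else 0)" for x
      using lim by simp
  qed
qed

lemma borel_measurable_matrix_mean:
  fixes X Y :: "'a \<Rightarrow> complex^'n^'n"
  assumes f: "continuous_on {0<..} f"
    and [measurable]: "X \<in> borel_measurable M" "Y \<in> borel_measurable M"
  shows "(\<lambda>x. matrix_mean f (X x) (Y x)) \<in> borel_measurable M"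
proof -
  define R where "R x = (if posdef (X x) then mat_fun (\<lambda>t. t powr (1/2)) (X x) else 0)" for x
  define Q where "Q x = (if posdef (X x) then mat_fun (\<lambda>t. t powr (- (1/2))) (X x) else 0)" for x
  have [measurable]: "R \<in> borel_measurable M" "Q \<in> borel_measurable M"
    unfolding R_def Q_def by (intro borel_measurable_mat_fun continuous_intros; simp)+
  define G where "G x = (if posdef (Q x ** Y x ** Q x) then mat_fun f (Q x ** Y x ** Q x) else 0)" for x
  have [measurable]: "G \<in> borel_measurable M"
    unfolding G_def by (intro borel_measurable_mat_fun f) measurable
  have "matrix_mean f (X x) (Y x) = (if posdef (X x) \<and> posdef (Y x) then R x ** G x ** R x else 0)" for x
  proof (cases "posdef (X x) \<and> posdef (Y x)")
    case True
    \<comment> \<open>\<open>Q x ** Y x ** Q x\<close> is positive definite here, so the default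
      value 0 in \<open>G\<close> is not taken.\<close>
    then show ?thesis
      using posdef_congruence[of "Y x" "R x" "Q x"] posdef_sqrt[of "X x"]
      by (simp add: matrix_mean_def Let_def R_def Q_def G_def)
  qed (auto simp: matrix_mean_def)
  then show ?thesis by simp
qed

section \<open>The inequality for means\<close>

theorem theorem8p2:
  fixes M :: "'w measure"
    and X Y \<rho> :: "'w \<Rightarrow> complex^'n^'n"
    and f :: "real \<Rightarrow> real"
  assumes "prob_space M"
    and "posdef_random_matrix M X"
    and "posdef_random_matrix M Y"
    and "f \<in> F_op TYPE('i::infinite \<Rightarrow> complex)"
    and "random_density_matrix M \<rho>"
    and "integrable M (pointwise_expectation \<rho> X)"
    and "integrable M (pointwise_expectation \<rho> Y)"
  shows "integrable M (pointwise_expectation \<rho> (random_mean f X Y)) \<and>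
         mean_expectation M \<rho> (random_mean f X Y)
           \<le> scalar_mean f (mean_expectation M \<rho> X) (mean_expectation M \<rho> Y)"
proof -
  interpret prob_space M by fact
  let ?E = "pointwise_expectation \<rho>" and ?Z = "random_mean f X Y"
  define a where "a = mean_expectation M \<rho> X"
  define b where "b = mean_expectation M \<rho> Y"
  have intX: "integrable M (\<lambda>\<omega>. Re (?E X \<omega>))" and intY: "integrable M (\<lambda>\<omega>. Re (?E Y \<omega>))"
    using assms(6,7) by auto
  have a: "a = (\<integral>\<omega>. Re (?E X \<omega>) \<partial>M)" and b: "b = (\<integral>\<omega>. Re (?E Y \<omega>) \<partial>M)"
    using assms(6,7) by (simp_all add: a_def b_def mean_expectation_def)
  have pd: "AE \<omega> in M. possemidef (\<rho> \<omega>) \<and> trace (\<rho> \<omega>) = 1 \<and> posdef (X \<omega>) \<and> posdef (Y \<omega>)"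
    using assms(2,3,5) by (auto simp: posdef_random_matrix_def random_density_matrix_def)
  then have "AE \<omega> in M. 0 < Re (?E X \<omega>)" "AE \<omega> in M. 0 < Re (?E Y \<omega>)"
    by (eventually_elim; simp add: pointwise_expectation_def trace_mult_posdef_pos)+
  \<comment> \<open>An almost everywhere positive integrand has a positive integral on a space of
    mass 1; thus \<open>b / a\<close> lies in the open half-line.\<close>
  then have pos: "0 < a" "0 < b"
    using integral_less_AE_space[of "\<lambda>_. 0"] intX intY by (simp_all add: a b emeasure_space_1)
  then obtain k where k: "\<And>t. 0 < t \<Longrightarrow> f t \<le> f (b / a) + k * (t - b / a)"
    using concave_on_supporting_line[OF F_op_concave_on[OF assms(4)], of "b / a"] by auto
  \<comment> \<open>The supporting line at \<open>b / a\<close> in homogeneous form: its intercept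
    multiplies the trace with \<open>X\<close>, its slope the trace with \<open>Y\<close>.\<close>
  define h where "h \<omega> = (f (b / a) - k * (b / a)) * Re (?E X \<omega>) + k * Re (?E Y \<omega>)" for \<omega>
  have inth: "integrable M h"
    unfolding h_def using intX intY by simp
  \<comment> \<open>Being real and nonnegative, the trace has its real part as its norm; the upper
    bound \<open>h\<close> then yields integrability as well as the inequality.\<close>
  have bound: "AE \<omega> in M. ?E ?Z \<omega> = complex_of_real (Re (?E ?Z \<omega>)) \<and>
      0 \<le> Re (?E ?Z \<omega>) \<and> Re (?E ?Z \<omega>) \<le> h \<omega>"
    using pd
  proof eventually_elim
    fix \<omega> assume *: "possemidef (\<rho> \<omega>) \<and> trace (\<rho> \<omega>) = 1 \<and> posdef (X \<omega>) \<and> posdef (Y \<omega>)"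
    then have 1: "possemidef (\<rho> \<omega>)" and 2: "posdef (X \<omega>)" and 3: "posdef (Y \<omega>)"
      by auto
    obtain w c :: "'n \<Rightarrow> real" where w: "\<And>j. 0 \<le> w j" "\<And>j. 0 < c j"
      "trace (\<rho> \<omega> ** X \<omega>) = complex_of_real (\<Sum>j\<in>UNIV. w j)"
      "trace (\<rho> \<omega> ** Y \<omega>) = complex_of_real (\<Sum>j\<in>UNIV. w j * c j)"
      "\<And>g. trace (\<rho> \<omega> ** matrix_mean g (X \<omega>) (Y \<omega>)) = complex_of_real (\<Sum>j\<in>UNIV. w j * g (c j))"
      by (rule matrix_mean_trace[OF 1 2 3]) (rule that)
    \<comment> \<open>The supporting line is evaluated at each eigenvalue \<open>c j\<close> and
      weighted by \<open>w j\<close>.\<close>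
    have "(\<Sum>j\<in>UNIV. w j * f (c j)) \<le> (\<Sum>j\<in>UNIV. w j * (f (b / a) + k * (c j - b / a)))"
      using w k by (intro sum_mono mult_left_mono) auto
    also have "\<dots> = (\<Sum>j\<in>UNIV. (f (b / a) - k * (b / a)) * w j + k * (w j * c j))"
      by (intro sum.cong) (auto simp: algebra_simps)
    also have "\<dots> = h \<omega>"
      unfolding sum.distrib by (simp add: h_def pointwise_expectation_def w flip: sum_distrib_left)
    finally have "(\<Sum>j\<in>UNIV. w j * f (c j)) \<le> h \<omega>" .
    moreover have "0 \<le> (\<Sum>j\<in>UNIV. w j * f (c j))"
      using w assms(4) by (intro sum_nonneg mult_nonneg_nonneg) (auto simp: F_op_def less_imp_le)
    ultimately show "?E ?Z \<omega> = complex_of_real (Re (?E ?Z \<omega>)) \<and>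
        0 \<le> Re (?E ?Z \<omega>) \<and> Re (?E ?Z \<omega>) \<le> h \<omega>"
      by (simp add: pointwise_expectation_def random_mean_def w)
  qed
  have [measurable]: "\<rho> \<in> borel_measurable M" "?Z \<in> borel_measurable M"
    using assms(2,3,5) F_op_continuous_on[OF assms(4)] unfolding random_mean_def
    by (auto simp: posdef_random_matrix_def random_density_matrix_def intro!: borel_measurable_matrix_mean)
  have intZ: "integrable M (?E ?Z)"
  proof (rule Bochner_Integration.integrable_bound[OF inth])
    show "?E ?Z \<in> borel_measurable M"
      unfolding pointwise_expectation_def by measurable
    show "AE \<omega> in M. norm (?E ?Z \<omega>) \<le> norm (h \<omega>)"
      using bound
    proof eventually_elim
      case (elim \<omega>)
      then have "norm (?E ?Z \<omega>) = Re (?E ?Z \<omega>)"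
        by (metis abs_of_nonneg norm_of_real)
      then show ?case using elim by simp
    qed
  qed
  have "mean_expectation M \<rho> ?Z = (\<integral>\<omega>. Re (?E ?Z \<omega>) \<partial>M)"
    using intZ by (simp add: mean_expectation_def)
  also have "\<dots> \<le> (\<integral>\<omega>. h \<omega> \<partial>M)"
    using intZ inth bound by (intro integral_mono_AE) auto
  also have "\<dots> = (f (b / a) - k * (b / a)) * a + k * b"
    unfolding h_def using intX intY by (simp add: a b)
  \<comment> \<open>The terms with \<open>k\<close> cancel because the line was taken at the
    quotient \<open>b / a\<close>, which leaves \<open>a * f (b / a)\<close>.\<close>
  also have "\<dots> = scalar_mean f a b"
    using pos by (simp add: scalar_mean_def field_simps)
  finally show ?thesis
    using intZ by (simp add: a_def b_def)
qed

end
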